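(* Let $G$ be a group, $Y\subseteq G$ a finite set containing at least two elements which generates $G$ as a semigroup, and $F:Y\to\mathbb R$ a function with $F(s)>0$ for all $s\in Y$. Assume that the abelianization $G/[G,G]$ has rank $n\ge1$. Then the set $N_\infty\subseteq\Delta_Y$ is homeomorphic to the $(n-1)$-sphere $S^{n-1}$.
   Context: $\Delta_Y=\{p\in[0,1]^Y:\sum_{s\in Y}p_s=1\}$. For $\beta\in\mathbb R$, $Q(\beta)=\{c\in\mathrm{Hom}(G,\mathbb R):\sum_{s\in Y}e^{c(s)-\beta F(s)}=1\}$. Let $\beta_0>0$ be the least $\beta$ for which $Q(\beta)\ne\emptyset$ (equivalently, the least inverse temperature at which the associated generalized gauge action has an abelian KMS state); it exists under the stated hypotheses. For $\beta>\beta_0$ set $$N_\beta=\left\{\left(e^{-\beta F(s)}e^{c(s)}\right)_{s\in Y}: c\in Q(\beta)\right\}\subseteq\Delta_Y,$$ and let $N_\infty$ be the limit set of $N_\beta$ as $\beta\to\infty$: $$N_\infty=\bigcap_{r>\beta_0}\overline{\bigcup_{\beta\ge r}N_\beta}.$$ $S^{n-1}=\{v\in\mathbb R^n:\|v\|=1\}$. *)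

theory Defs
  imports "HOL-Analysis.Analysis" "HOL-Algebra.Generated_Groups" "HOL-Algebra.FiniteProduct"
begin

definition real_group :: "real monoid"
  where "real_group = \<lparr>carrier = UNIV, monoid.mult = (+), one = 0\<rparr>"

text \<open>The subsemigroup generated by a set: all products of one or more elements of the set.
  Neither the identity nor inverses are added for free.\<close>

inductive_set semigroup_generate :: "('a, 'b) monoid_scheme \<Rightarrow> 'a set \<Rightarrow> 'a set"
  for G :: "('a, 'b) monoid_scheme" and Y :: "'a set"
where
  incl: "y \<in> Y \<Longrightarrow> y \<in> semigroup_generate G Y"
| mult: "x \<in> semigroup_generate G Y \<Longrightarrow> y \<in> semigroup_generate G Y \<Longrightarrow>
    x \<otimes>\<^bsub>G\<^esub> y \<in> semigroup_generate G Y"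

definition abelianization :: "('a, 'b) monoid_scheme \<Rightarrow> 'a set monoid"
  where "abelianization G = G Mod (derived G (carrier G))"

definition int_independent :: "('a, 'b) monoid_scheme \<Rightarrow> 'a set \<Rightarrow> bool"
  where "int_independent A B \<longleftrightarrow> finite B \<and> B \<subseteq> carrier A \<and>
    (\<forall>k :: 'a \<Rightarrow> int. finprod A (\<lambda>b. b [^]\<^bsub>A\<^esub> k b) B = \<one>\<^bsub>A\<^esub> \<longrightarrow> (\<forall>b\<in>B. k b = 0))"

text \<open>The rank of an abelian group is its torsion-free rank: the largest size of a set that is
  linearly independent over the integers.\<close>

definition has_rank :: "('a, 'b) monoid_scheme \<Rightarrow> nat \<Rightarrow> bool"
  where "has_rank A n \<longleftrightarrow>
    (\<exists>B. int_independent A B \<and> card B = n) \<and> (\<forall>B. int_independent A B \<longrightarrow> card B \<le> n)"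

text \<open>Vectors indexed by \<open>Y\<close> are extensional functions on \<open>Y\<close>.\<close>

definition Delta :: "'a set \<Rightarrow> ('a \<Rightarrow> real) set"
  where "Delta Y = {p \<in> Y \<rightarrow>\<^sub>E {0..1}. (\<Sum>s\<in>Y. p s) = 1}"

definition Delta_topology :: "'a set \<Rightarrow> ('a \<Rightarrow> real) topology"
  where "Delta_topology Y = subtopology (powertop_real Y) (Delta Y)"

text \<open>Members of \<^term>\<open>hom G real_group\<close> are unconstrained outside the carrier of \<open>G\<close>. This does
  not affect \<open>N_set\<close> or \<open>beta_0\<close> below, which depend only on values on \<open>Y\<close>.\<close>

definition Q_set :: "('a, 'b) monoid_scheme \<Rightarrow> 'a set \<Rightarrow> ('a \<Rightarrow> real) \<Rightarrow> real \<Rightarrow> ('a \<Rightarrow> real) set"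
  where "Q_set G Y F \<beta> = {c \<in> hom G real_group. (\<Sum>s\<in>Y. exp (c s - \<beta> * F s)) = 1}"

definition beta_0 :: "('a, 'b) monoid_scheme \<Rightarrow> 'a set \<Rightarrow> ('a \<Rightarrow> real) \<Rightarrow> real"
  where "beta_0 G Y F = (LEAST \<beta>. Q_set G Y F \<beta> \<noteq> {})"

definition N_set :: "('a, 'b) monoid_scheme \<Rightarrow> 'a set \<Rightarrow> ('a \<Rightarrow> real) \<Rightarrow> real \<Rightarrow> ('a \<Rightarrow> real) set"
  where "N_set G Y F \<beta> = (\<lambda>c. \<lambda>s\<in>Y. exp (- \<beta> * F s) * exp (c s)) ` Q_set G Y F \<beta>"

definition N_infinity :: "('a, 'b) monoid_scheme \<Rightarrow> 'a set \<Rightarrow> ('a \<Rightarrow> real) \<Rightarrow> ('a \<Rightarrow> real) set"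
  where "N_infinity G Y F =
    (\<Inter>r\<in>{beta_0 G Y F<..}. Delta_topology Y closure_of (\<Union>\<beta>\<in>{r..}. N_set G Y F \<beta>))"

end

theory Submission
  imports Defs
begin

text \<open>
  Let \<open>W\<close> be the space of restrictions to \<open>Y\<close> of real homomorphisms, and send \<open>p \<in> \<Delta>\<^sub>Y\<close> to the
  functional \<open>\<mu>(p) = \<Sum>\<^sub>s p\<^sub>s ev\<^sub>s\<close> on \<open>W\<close>. The normal of the convex hypersurface \<open>Q(\<beta>)\<close> at \<open>c\<close> is \<open>\<mu>(p)\<close>
  for the point \<open>p\<close> of \<open>N\<^sub>\<beta>\<close> given by \<open>c\<close>, so \<open>\<mu>/\<bar>\<mu>\<bar>\<close> is the Gauss map for all \<open>\<beta>\<close> at once, and it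
  is a homeomorphism in the limit. Surjectivity on \<open>N\<^sub>\<infinity>\<close> follows by compactness from surjectivity on the
  \<open>N\<^sub>\<beta>\<close> (maximize a linear functional over \<open>\<Sum>\<^sub>s exp(c(s) - \<beta> F(s)) \<le> 1\<close>). For injectivity, if
  \<open>\<mu>(p) = t \<mu>(q)\<close>, then pairing with the limits \<open>x, y\<close> of \<open>c/\<beta>\<close> shows that \<open>p\<close> and \<open>q\<close> are supported
  where \<open>x = y = F\<close>; there the difference of the logarithms of their approximants lies in \<open>W\<close>, so the
  relative entropies satisfy \<open>D(p|q) = -t D(q|p)\<close> and both vanish.
\<close>

section \<open>Dual bases of the homomorphisms into the reals\<close>

text \<open>Fraction-free Gaussian elimination, by induction on the columns: a row \<open>a\<close>
  with nonzero entry in column \<open>j\<close> serves as pivot, and cross-multiplying clears that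
  column without leaving the integers.\<close>

lemma int_relation_exists:
  fixes M :: "'i \<Rightarrow> 'j \<Rightarrow> int"
  assumes "finite J" "finite I" "card J < card I"
  shows "\<exists>k. (\<exists>i\<in>I. k i \<noteq> 0) \<and> (\<forall>j\<in>J. (\<Sum>i\<in>I. k i * M i j) = 0)"
  using assms
proof (induction J arbitrary: I M rule: finite_induct)
  case empty
  then have "I \<noteq> {}" by auto
  then show ?case by (intro exI[of _ "\<lambda>_. 1"]) auto
next
  case (insert j J)
  show ?case
  proof (cases "\<forall>i\<in>I. M i j = 0")
    case True
    have "card J < card I" using insert by simp
    from insert.IH[OF insert.prems(1) this, of M] obtain k where
      "\<exists>i\<in>I. k i \<noteq> 0" "\<forall>j\<in>J. (\<Sum>i\<in>I. k i * M i j) = 0" by blast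
    with True show ?thesis by (intro exI[of _ k]) auto
  next
    case False
    then obtain a where a: "a \<in> I" "M a j \<noteq> 0" by blast
    define I' where "I' = I - {a}"
    have I': "finite I'" "a \<notin> I'" "I = insert a I'" using insert.prems a by (auto simp: I'_def)
    have "card J < card I'" using insert I' by simp
    from insert.IH[OF I'(1) this, of "\<lambda>i l. M a j * M i l - M i j * M a l"]
    obtain k where k: "\<exists>i\<in>I'. k i \<noteq> 0"
      and k0: "\<forall>l\<in>J. (\<Sum>i\<in>I'. k i * (M a j * M i l - M i j * M a l)) = 0" by blast
    \<comment> \<open>The other coefficients are scaled by the pivot entry \<open>M a j\<close>; the
      coefficient of row \<open>a\<close> is then forced by the cross-multiplied rows.\<close>
    define k' where "k' i = (if i = a then - (\<Sum>i\<in>I'. k i * M i j) else k i * M a j)" for i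
    have sum_k': "(\<Sum>i\<in>I. k' i * M i l) = (\<Sum>i\<in>I'. k i * (M a j * M i l - M i j * M a l))" for l
    proof -
      have "(\<Sum>i\<in>I'. k' i * M i l) = (\<Sum>i\<in>I'. k i * M a j * M i l)"
        by (rule sum.cong) (use I' in \<open>auto simp: k'_def\<close>)
      then have "(\<Sum>i\<in>I. k' i * M i l) = (\<Sum>i\<in>I'. k i * M a j * M i l) - (\<Sum>i\<in>I'. k i * M i j) * M a l"
        using I' by (simp add: k'_def)
      also have "\<dots> = (\<Sum>i\<in>I'. k i * (M a j * M i l - M i j * M a l))"
        by (simp add: sum_subtractf sum_distrib_right right_diff_distrib mult.assoc)
      finally show ?thesis .
    qed
    have "(\<Sum>i\<in>I. k' i * M i j) = 0" unfolding sum_k' by (simp add: mult.commute)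
    moreover have "\<exists>i\<in>I. k' i \<noteq> 0" using k a I' by (auto simp: k'_def)
    ultimately show ?thesis using k0 by (intro exI[of _ k']) (simp add: sum_k')
  qed
qed

section \<open>Homomorphisms into the additive reals\<close>

lemma group_real_group: "group real_group"
proof (rule groupI)
  fix x :: real assume "x \<in> carrier real_group"
  show "\<exists>y\<in>carrier real_group. y \<otimes>\<^bsub>real_group\<^esub> x = \<one>\<^bsub>real_group\<^esub>"
    by (rule bexI[of _ "-x"]) (auto simp: real_group_def)
qed (auto simp: real_group_def)

lemma hom_real_group_iff:
  "c \<in> hom G real_group \<longleftrightarrow> (\<forall>x\<in>carrier G. \<forall>y\<in>carrier G. c (x \<otimes>\<^bsub>G\<^esub> y) = c x + c y)"
  by (auto simp: hom_def real_group_def)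

context group begin

lemma real_hom_one: "c \<in> hom G real_group \<Longrightarrow> c \<one> = 0"
  unfolding hom_real_group_iff by (metis add_cancel_right_right one_closed r_one)

lemma real_hom_inv: "c \<in> hom G real_group \<Longrightarrow> x \<in> carrier G \<Longrightarrow> c (inv x) = - c x"
  using real_hom_one[of c] unfolding hom_real_group_iff
  by (metis add.inverse_inverse add_eq_0_iff inv_closed r_inv)

lemma real_hom_nat_pow:
  assumes "c \<in> hom G real_group" "x \<in> carrier G"
  shows "c (x [^] (k::nat)) = real k * c x"
proof (induction k)
  case 0 then show ?case using real_hom_one assms by simp
next
  case (Suc k)
  have "c (x [^] k \<otimes> x) = c (x [^] k) + c x" using assms unfolding hom_real_group_iff by auto
  with Suc show ?case by (simp add: algebra_simps)
qed

lemma real_hom_int_pow: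
  assumes "c \<in> hom G real_group" "x \<in> carrier G"
  shows "c (x [^] (k::int)) = real_of_int k * c x"
proof (cases k)
  case (nonneg n) then show ?thesis using real_hom_nat_pow[OF assms] by (simp add: int_pow_int)
next
  case (neg n)
  then show ?thesis using real_hom_nat_pow[OF assms, of "Suc n"] real_hom_inv[OF assms(1)] assms(2)
    by (simp add: int_pow_neg_int del: of_nat_Suc nat_pow_Suc)
qed

text \<open>Addition of reals is commutative, so commutators go to 0. This lets every real
  homomorphism descend to the abelianization.\<close>

lemma derived_subset_real_hom_kernel:
  assumes "c \<in> hom G real_group"
  shows "derived G (carrier G) \<subseteq> kernel G real_group c"
proof -
  interpret H: group_hom G real_group c
    using assms group_real_group by (simp add: group_hom_def group_hom_axioms_def)
  show ?thesis
    unfolding derived_def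
    by (rule generate_subgroup_incl[OF _ H.subgroup_kernel])
      (use real_hom_inv[OF assms] assms in \<open>auto simp: kernel_def hom_real_group_iff real_group_def\<close>)
qed

end

section \<open>Integer combinations, independence and rank\<close>

definition int_comb :: "('a, 'b) monoid_scheme \<Rightarrow> 'a set \<Rightarrow> ('a \<Rightarrow> int) \<Rightarrow> 'a"
  where "int_comb A B m = finprod A (\<lambda>b. b [^]\<^bsub>A\<^esub> m b) B"

context comm_group begin

lemma int_comb_closed: "B \<subseteq> carrier G \<Longrightarrow> int_comb G B m \<in> carrier G"
  unfolding int_comb_def by (rule finprod_closed) auto

lemma int_comb_add:
  assumes "B \<subseteq> carrier G"
  shows "int_comb G B (\<lambda>b. m b + m' b) = int_comb G B m \<otimes> int_comb G B m'"
proof -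
  have "int_comb G B (\<lambda>b. m b + m' b) = finprod G (\<lambda>b. b [^] m b \<otimes> b [^] m' b) B"
    unfolding int_comb_def by (rule finprod_cong) (use assms in \<open>auto simp: int_pow_mult simp_implies_def\<close>)
  then show ?thesis unfolding int_comb_def using assms by (simp add: Pi_def subset_iff)
qed

lemma int_comb_zero: "int_comb G B (\<lambda>_. 0) = \<one>"
  unfolding int_comb_def by simp

lemma int_comb_insert:
  assumes "finite B" "b \<notin> B" "insert b B \<subseteq> carrier G"
  shows "int_comb G (insert b B) m = b [^] m b \<otimes> int_comb G B m"
  unfolding int_comb_def by (rule finprod_insert) (use assms in auto)

lemma int_comb_cong: "B \<subseteq> carrier G \<Longrightarrow> (\<And>b. b \<in> B \<Longrightarrow> m b = m' b) \<Longrightarrow> int_comb G B m = int_comb G B m'"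
  unfolding int_comb_def by (rule finprod_cong) (auto simp: simp_implies_def)

lemma int_comb_scale:
  assumes "finite B" "B \<subseteq> carrier G"
  shows "int_comb G B (\<lambda>b. k * m b) = int_comb G B m [^] k"
  using assms
proof (induction B rule: finite_induct)
  case empty then show ?case by (simp add: int_comb_def)
next
  case (insert b B)
  then have "int_comb G B m \<in> carrier G" by (simp add: int_comb_closed)
  with insert show ?case
    by (simp add: int_comb_insert int_pow_pow int_pow_mult_distrib m_comm mult.commute)
qed

lemma int_comb_unit:
  assumes "finite B" "B \<subseteq> carrier G" "b \<in> B"
  shows "int_comb G B (\<lambda>b'. if b' = b then 1 else 0) = b"
proof -
  have "int_comb G B (\<lambda>b'. if b' = b then 1 else 0) = finprod G (\<lambda>b'. if b' = b then b' else \<one>) B"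
    unfolding int_comb_def by (rule finprod_cong) (use assms in \<open>auto simp: simp_implies_def\<close>)
  also have "\<dots> = b" using finprod_singleton_swap[of b B "\<lambda>x. x"] assms by auto
  finally show ?thesis .
qed

lemma real_hom_int_comb:
  assumes c: "c \<in> hom G real_group" and "finite B" "B \<subseteq> carrier G"
  shows "c (int_comb G B m) = (\<Sum>b\<in>B. real_of_int (m b) * c b)"
  using assms(2,3)
proof (induction B rule: finite_induct)
  case empty then show ?case using real_hom_one c by (simp add: int_comb_def)
next
  case (insert b B)
  then have "int_comb G B m \<in> carrier G" by (simp add: int_comb_closed)
  with insert c show ?case
    by (simp add: int_comb_insert real_hom_int_pow[symmetric]) (auto simp: hom_real_group_iff)
qed

text \<open>Turns a linear relation between the rows \<open>m e\<close> into a relation between the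
  group elements \<open>e\<close>.\<close>

lemma int_comb_combine:
  assumes E: "finite E" "E \<subseteq> carrier G" and B: "finite B" "B \<subseteq> carrier G"
    and "\<And>e. e \<in> E \<Longrightarrow> e [^] (k e) = int_comb G B (m e)"
  shows "int_comb G E (\<lambda>e. l e * k e) = int_comb G B (\<lambda>b. \<Sum>e\<in>E. l e * m e b)"
  using E assms(5)
proof (induction E rule: finite_induct)
  case empty then show ?case by (simp add: int_comb_zero) (simp add: int_comb_def)
next
  case (insert e E)
  have "e [^] (l e * k e) = (e [^] k e) [^] l e"
    using insert.prems(1) by (subst int_pow_pow) (auto simp: mult.commute)
  also have "\<dots> = int_comb G B (\<lambda>b. l e * m e b)" using insert.prems(2)[of e] B by (simp add: int_comb_scale)
  finally show ?case using insert B
    by (simp add: int_comb_insert int_comb_add)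
qed

lemma int_independentD:
  assumes "int_independent G B" "int_comb G B m = \<one>" "b \<in> B"
  shows "m b = 0"
proof -
  have "finprod G (\<lambda>b. b [^] m b) B = \<one> \<longrightarrow> (\<forall>b\<in>B. m b = 0)"
    using assms(1) unfolding int_independent_def by (elim conjE allE[of _ m])
  then show ?thesis using assms(2,3) unfolding int_comb_def by simp
qed

lemma int_comb_inj:
  assumes B: "int_independent G B" and eq: "int_comb G B m = int_comb G B m'" and b: "b \<in> B"
  shows "m b = m' b"
proof -
  have f: "finite B" "B \<subseteq> carrier G" using B by (auto simp: int_independent_def)
  have "int_comb G B (\<lambda>b. m b + (-1) * m' b) = int_comb G B m \<otimes> int_comb G B m [^] (-1::int)"
    using f eq by (subst int_comb_add, simp, subst int_comb_scale) auto
  also have "\<dots> = \<one>" using int_comb_closed[OF f(2), of m] by (simp add: int_pow_neg)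
  finally have "int_comb G B (\<lambda>b. m b + (-1) * m' b) = \<one>" .
  then have "m b + (-1) * m' b = 0" by (rule int_independentD[OF B _ b])
  then show ?thesis by simp
qed

text \<open>Modulo torsion this is the rational span of \<open>B\<close> inside the group; the
  nonzero exponent \<open>k\<close> acts as a common denominator.\<close>

definition int_span :: "'a set \<Rightarrow> 'a set"
  where "int_span B = {g \<in> carrier G. \<exists>k m. k \<noteq> (0::int) \<and> g [^] k = int_comb G B m}"

lemma int_span_mult:
  assumes "finite B" "B \<subseteq> carrier G" "g \<in> carrier G" "h \<in> carrier G"
    "g [^] (k::int) = int_comb G B m" "h [^] l = int_comb G B m'"
  shows "(g \<otimes> h) [^] (k * l) = int_comb G B (\<lambda>b. l * m b + k * m' b)"
proof -
  have "(g \<otimes> h) [^] (k * l) = (g [^] k) [^] l \<otimes> (h [^] l) [^] k"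
    using assms(3,4) by (simp add: int_pow_mult_distrib m_comm int_pow_pow mult.commute)
  then show ?thesis using assms by (simp add: int_comb_add int_comb_scale)
qed

text \<open>Steinitz bound: if \<open>E\<close> were larger, the rows \<open>m e\<close> would
  satisfy a nontrivial integer relation \<open>l\<close>, and the exponents \<open>l e * k e\<close>
  would give a nontrivial relation in \<open>E\<close>, since no \<open>k e\<close>
  vanishes.\<close>

lemma card_int_independent_le:
  assumes E: "int_independent G E" and B: "finite B" "B \<subseteq> carrier G" and "E \<subseteq> int_span B"
  shows "card E \<le> card B"
proof (rule ccontr)
  assume "\<not> card E \<le> card B"
  then have lt: "card B < card E" by simp
  have fE: "finite E" "E \<subseteq> carrier G" using E by (auto simp: int_independent_def)
  have "\<forall>e\<in>E. \<exists>k m. k \<noteq> (0::int) \<and> e [^] k = int_comb G B m" using assms by (auto simp: int_span_def)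
  then obtain k m where km: "\<And>e. e \<in> E \<Longrightarrow> k e \<noteq> (0::int)" "\<And>e. e \<in> E \<Longrightarrow> e [^] k e = int_comb G B (m e)"
    by metis
  obtain l where l: "\<exists>e\<in>E. l e \<noteq> 0" "\<forall>b\<in>B. (\<Sum>e\<in>E. l e * m e b) = 0"
    using int_relation_exists[OF B(1) fE(1) lt, of m] by blast
  have "int_comb G E (\<lambda>e. l e * k e) = int_comb G B (\<lambda>b. \<Sum>e\<in>E. l e * m e b)"
    by (rule int_comb_combine) (use fE B km in auto)
  also have "\<dots> = int_comb G B (\<lambda>_. 0)" by (rule int_comb_cong) (use B l in auto)
  finally have "int_comb G E (\<lambda>e. l e * k e) = \<one>" by (simp add: int_comb_zero)
  then have "\<forall>e\<in>E. l e * k e = 0" using int_independentD[OF E] by blast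
  with l km show False by auto
qed

text \<open>Each \<open>\<phi> b\<close> is a coordinate function: if the power \<open>k g\<close>
  of \<open>g\<close> has exponents \<open>m g\<close> in \<open>B\<close>, the coordinate at
  \<open>b\<close> is the fraction \<open>m g b / k g\<close>.\<close>

lemma dual_homs_exist:
  assumes B: "int_independent G B" and span: "carrier G \<subseteq> int_span B"
  shows "\<exists>\<phi>. (\<forall>b\<in>B. \<phi> b \<in> hom G real_group \<and> (\<forall>b'\<in>B. \<phi> b b' = (if b' = b then 1 else 0))) \<and>
    (\<forall>c\<in>hom G real_group. \<forall>g\<in>carrier G. c g = (\<Sum>b\<in>B. c b * \<phi> b g))"
proof -
  have f: "finite B" "B \<subseteq> carrier G" using B by (auto simp: int_independent_def)
  have "\<forall>g\<in>carrier G. \<exists>k m. k \<noteq> (0::int) \<and> g [^] k = int_comb G B m" using span by (auto simp: int_span_def)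
  then obtain k m where k0: "\<And>g. g \<in> carrier G \<Longrightarrow> k g \<noteq> (0::int)"
    and km: "\<And>g. g \<in> carrier G \<Longrightarrow> g [^] k g = int_comb G B (m g)" by metis
  define \<phi> where "\<phi> b g = real_of_int (m g b) / real_of_int (k g)" for b g
  \<comment> \<open>Any representation of a nonzero power of \<open>g\<close> yields the same
    fraction: two of them are compared at the exponent \<open>k g * k'\<close>, where independence
    applies.\<close>
  have \<phi>: "\<phi> b g = real_of_int (m' b) / real_of_int k'"
    if "g \<in> carrier G" "k' \<noteq> 0" "g [^] k' = int_comb G B m'" "b \<in> B" for b g k' m'
  proof -
    have "int_comb G B (\<lambda>b. k' * m g b) = int_comb G B (\<lambda>b. k g * m' b)"
      using that f km[OF that(1)] by (simp add: int_comb_scale int_pow_pow mult.commute flip: km that(3))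
    then have "k' * m g b = k g * m' b" using int_comb_inj[OF B] that(4) by blast
    then have "real_of_int k' * real_of_int (m g b) = real_of_int (k g) * real_of_int (m' b)"
      by (metis of_int_mult)
    then show ?thesis using that k0 by (simp add: \<phi>_def field_simps)
  qed
  have "\<phi> b \<in> hom G real_group" if "b \<in> B" for b
    unfolding hom_real_group_iff
  proof (intro ballI)
    fix g h assume gh: "g \<in> carrier G" "h \<in> carrier G"
    have "\<phi> b (g \<otimes> h) = real_of_int (k h * m g b + k g * m h b) / real_of_int (k g * k h)"
      by (rule \<phi>) (use gh k0 km f that int_span_mult in auto)
    then show "\<phi> b (g \<otimes> h) = \<phi> b g + \<phi> b h" using gh k0 by (simp add: \<phi>_def field_simps)
  qed
  moreover have "\<phi> b b' = (if b' = b then 1 else 0)" if "b \<in> B" "b' \<in> B" for b b'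
    using \<phi>[of b' 1 "\<lambda>x. if x = b' then 1 else 0" b] f that int_comb_unit[OF f that(2)] by auto
  moreover have "c g = (\<Sum>b\<in>B. c b * \<phi> b g)" if "c \<in> hom G real_group" "g \<in> carrier G" for c g
  proof -
    have "real_of_int (k g) * c g = (\<Sum>b\<in>B. real_of_int (m g b) * c b)"
      using real_hom_int_comb[OF that(1) f, of "m g"] real_hom_int_pow[OF that, of "k g"] km[OF that(2)] by simp
    then have "c g = (\<Sum>b\<in>B. real_of_int (m g b) * c b) / real_of_int (k g)"
      using k0[OF that(2)] by (simp add: field_simps)
    then show ?thesis by (simp add: \<phi>_def sum_divide_distrib mult.commute)
  qed
  ultimately show ?thesis by (intro exI[of _ \<phi>]) auto
qed

text \<open>A maximal independent subset of \<open>Z\<close> spans \<open>Z\<close>, hence all that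
  \<open>Z\<close> generates, and the Steinitz bound gives it the size of the rank. Having the basis
  inside \<open>Z\<close> later makes values at points of \<open>Y\<close> usable as
  coordinates.\<close>

lemma basis_in_generating_set:
  assumes Z: "finite Z" "Z \<subseteq> carrier G" and gen: "semigroup_generate G Z = carrier G"
    and rank: "has_rank G n"
  shows "\<exists>B\<subseteq>Z. int_independent G B \<and> card B = n \<and> carrier G \<subseteq> int_span B"
proof -
  define P where "P = {B. B \<subseteq> Z \<and> int_independent G B}"
  have "finite P" unfolding P_def using Z by auto
  moreover have "{} \<in> P" by (auto simp: P_def int_independent_def)
  ultimately obtain B where BP: "B \<in> P" and maxB: "\<And>C. C \<in> P \<Longrightarrow> B \<subseteq> C \<Longrightarrow> B = C"
    using finite_has_maximal[of P] by blast
  have BZ: "B \<subseteq> Z" and B: "int_independent G B" using BP by (auto simp: P_def)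
  have f: "finite B" "B \<subseteq> carrier G" using B by (auto simp: int_independent_def)
  have zspan: "z \<in> int_span B" if z: "z \<in> Z" for z
  proof (cases "z \<in> B")
    case True
    then show ?thesis using int_comb_unit[OF f True] f
      by (auto simp: int_span_def intro!: exI[of _ "1::int"] exI[of _ "\<lambda>b. if b = z then 1 else 0"])
  next
    case False
    then have "insert z B \<notin> P" using maxB[of "insert z B"] by auto
    then have "\<not> int_independent G (insert z B)" using z BZ by (auto simp: P_def)
    then obtain k where k: "int_comb G (insert z B) k = \<one>" "\<exists>b\<in>insert z B. k b \<noteq> 0"
      using z f Z by (auto simp: int_independent_def int_comb_def)
    have zc: "z \<in> carrier G" using z Z by auto
    have eq: "z [^] k z \<otimes> int_comb G B k = \<one>" using k(1) False f zc by (simp add: int_comb_insert)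
    \<comment> \<open>A relation within \<open>B\<close> alone would be trivial, so \<open>z\<close>
      occurs with nonzero exponent and can be isolated.\<close>
    have "k z \<noteq> 0"
    proof
      assume 0: "k z = 0"
      then have "int_comb G B k = \<one>" using eq zc f int_comb_closed by simp
      then have "\<forall>b\<in>B. k b = 0" using int_independentD[OF B] by blast
      with k 0 show False by auto
    qed
    moreover have "z [^] (- k z) = int_comb G B k"
      using eq zc f int_comb_closed[OF f(2), of k] by (simp add: int_pow_neg inv_equality m_comm)
    ultimately show ?thesis using zc by (auto simp: int_span_def intro!: exI[of _ "- k z"])
  qed
  have span: "carrier G \<subseteq> int_span B"
  proof
    fix g assume "g \<in> carrier G"
    then have "g \<in> semigroup_generate G Z" using gen by simp
    then show "g \<in> int_span B"
    proof induction
      case (incl y) then show ?case by (rule zspan)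
    next
      case (mult x y)
      then obtain k m l m' where "x \<in> carrier G" "y \<in> carrier G" "k \<noteq> 0" "l \<noteq> 0"
        "x [^] (k::int) = int_comb G B m" "y [^] (l::int) = int_comb G B m'" by (auto simp: int_span_def)
      with int_span_mult[OF f this(1,2,5,6)] show ?case unfolding int_span_def
        by (auto intro!: exI[of _ "k * l"])
    qed
  qed
  obtain E where E: "int_independent G E" "card E = n" using rank by (auto simp: has_rank_def)
  have "E \<subseteq> int_span B" using E span by (auto simp: int_independent_def)
  then have "n \<le> card B" using card_int_independent_le[OF E(1) f] E by simp
  moreover have "card B \<le> n" using B rank by (auto simp: has_rank_def)
  ultimately show ?thesis using BZ B span by (intro exI[of _ B]) auto
qed

end

section \<open>From the abelianization back to the generators\<close>

lemma (in group) dual_basis_on_generators: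
  assumes Y: "Y \<subseteq> carrier G" "finite Y" and gen: "semigroup_generate G Y = carrier G"
    and rank: "has_rank (abelianization G) n"
  shows "\<exists>B \<phi>. B \<subseteq> Y \<and> card B = n \<and>
    (\<forall>b\<in>B. \<phi> b \<in> hom G real_group \<and> (\<forall>b'\<in>B. \<phi> b b' = (if b' = b then 1 else 0))) \<and>
    (\<forall>c\<in>hom G real_group. \<forall>g\<in>carrier G. c g = (\<Sum>b\<in>B. c b * \<phi> b g))"
proof -
  let ?N = "derived G (carrier G)"
  let ?A = "abelianization G"
  define \<pi> where "\<pi> g = ?N #> g" for g
  interpret N: normal ?N G by (rule derived_self_is_normal)
  interpret A: comm_group ?A unfolding abelianization_def by (rule derived_quot_is_comm_group)
  have \<pi>: "\<pi> \<in> hom G ?A" unfolding \<pi>_def abelianization_def by (rule N.r_coset_hom_Mod)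
  have carrier_A: "carrier ?A = \<pi> ` carrier G"
    by (auto simp: abelianization_def FactGroup_def RCOSETS_def \<pi>_def)
  have genA: "semigroup_generate ?A (\<pi> ` Y) = carrier ?A"
  proof (intro equalityI subsetI)
    fix x assume "x \<in> semigroup_generate ?A (\<pi> ` Y)"
    then show "x \<in> carrier ?A"
      by induction (use Y carrier_A A.m_closed in blast)+
  next
    fix x assume "x \<in> carrier ?A"
    then obtain g where g: "g \<in> carrier G" "x = \<pi> g" using carrier_A by auto
    from g(1) have "g \<in> semigroup_generate G Y" using gen by simp
    then have "\<pi> g \<in> semigroup_generate ?A (\<pi> ` Y)"
    proof induction
      case (mult x y)
      then have "\<pi> (x \<otimes> y) = \<pi> x \<otimes>\<^bsub>?A\<^esub> \<pi> y" using \<pi> gen by (auto simp: hom_def)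
      with mult show ?case by (auto intro: semigroup_generate.mult)
    qed (auto intro: semigroup_generate.incl)
    then show "x \<in> semigroup_generate ?A (\<pi> ` Y)" using g by simp
  qed
  have "finite (\<pi> ` Y)" "\<pi> ` Y \<subseteq> carrier ?A" using Y carrier_A by auto
  from A.basis_in_generating_set[OF this genA rank] obtain C where C: "C \<subseteq> \<pi> ` Y"
    "int_independent ?A C" "card C = n" "carrier ?A \<subseteq> A.int_span C" by blast
  from A.dual_homs_exist[OF C(2,4)] obtain \<psi> where
    \<psi>: "\<And>b. b \<in> C \<Longrightarrow> \<psi> b \<in> hom ?A real_group"
      "\<And>b b'. b \<in> C \<Longrightarrow> b' \<in> C \<Longrightarrow> \<psi> b b' = (if b' = b then 1 else 0)"
      "\<And>c g. c \<in> hom ?A real_group \<Longrightarrow> g \<in> carrier ?A \<Longrightarrow> c g = (\<Sum>b\<in>C. c b * \<psi> b g)" by blast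
  \<comment> \<open>One generator is chosen above each basis element of the abelianization, so
    \<open>\<pi>\<close> is injective on \<open>B\<close> and the cardinality survives.\<close>
  obtain B where B: "B \<subseteq> Y" "inj_on \<pi> B" "C = \<pi> ` B"
    using C(1) by (auto simp: subset_image_inj)
  define \<phi> where "\<phi> b g = \<psi> (\<pi> b) (\<pi> g)" for b g
  have "card B = n" using C(3) B(2,3) by (simp add: card_image)
  moreover have "\<phi> b \<in> hom G real_group" if "b \<in> B" for b
    using \<psi>(1)[of "\<pi> b"] that B \<pi> carrier_A by (auto simp: hom_real_group_iff hom_def \<phi>_def)
  moreover have "\<phi> b b' = (if b' = b then 1 else 0)" if "b \<in> B" "b' \<in> B" for b b'
    using \<psi>(2)[of "\<pi> b" "\<pi> b'"] that B by (auto simp: \<phi>_def inj_on_def)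
  moreover have "c g = (\<Sum>b\<in>B. c b * \<phi> b g)" if c: "c \<in> hom G real_group" and g: "g \<in> carrier G" for c g
  proof -
    interpret H: group_hom G real_group c
      using c group_real_group by (simp add: group_hom_def group_hom_axioms_def)
    obtain d where d: "d \<in> hom ?A real_group" "\<And>x. x \<in> carrier G \<Longrightarrow> d (\<pi> x) = c x"
      using H.FactGroup_universal_kernel[OF derived_self_is_normal derived_subset_real_hom_kernel[OF c]]
      unfolding abelianization_def \<pi>_def by blast
    have "c g = (\<Sum>b\<in>C. d b * \<psi> b (\<pi> g))" using \<psi>(3)[OF d(1), of "\<pi> g"] d(2) g carrier_A by auto
    also have "\<dots> = (\<Sum>b\<in>B. d (\<pi> b) * \<psi> (\<pi> b) (\<pi> g))" using B by (simp add: sum.reindex)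
    also have "\<dots> = (\<Sum>b\<in>B. c b * \<phi> b g)"
      by (rule sum.cong) (use B Y d(2) in \<open>auto simp: \<phi>_def\<close>)
    finally show ?thesis .
  qed
  ultimately show ?thesis using B(1) by (intro exI[of _ B] exI[of _ \<phi>]) auto
qed

text \<open>\<open>m t\<close> counts the occurrences of \<open>t\<close> in a word for
  \<open>x\<close>. Applied to the inverse of a generator \<open>s\<close>, this writes
  \<open>- c s\<close> as a nonnegative combination of values of \<open>c\<close> on
  \<open>Y\<close>.\<close>

lemma (in group) semigroup_generate_real_hom:
  assumes "finite Y" "Y \<subseteq> carrier G" "x \<in> semigroup_generate G Y"
  shows "\<exists>m::'a \<Rightarrow> real. (\<forall>t. 0 \<le> m t) \<and> x \<in> carrier G \<and> (\<forall>c\<in>hom G real_group. c x = (\<Sum>t\<in>Y. m t * c t))"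
  using assms(3)
proof induction
  case (incl y)
  then show ?case using assms
    by (intro exI[of _ "\<lambda>t. if t = y then 1 else 0"]) (auto simp: if_distrib[of "\<lambda>m. m * _"] sum.delta cong: if_cong)
next
  case (mult x y)
  then obtain m m' :: "'a \<Rightarrow> real" where m: "\<forall>t. 0 \<le> m t" "\<forall>t. 0 \<le> m' t" "x \<in> carrier G" "y \<in> carrier G"
    "\<forall>c\<in>hom G real_group. c x = (\<Sum>t\<in>Y. m t * c t)"
    "\<forall>c\<in>hom G real_group. c y = (\<Sum>t\<in>Y. m' t * c t)" by blast
  then show ?case
    by (intro exI[of _ "\<lambda>t. m t + m' t"]) (auto simp: hom_real_group_iff distrib_right sum.distrib)
qed

section \<open>The Gauss map on the limit set\<close>

lemma finite_coordinates_subsequence: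
  fixes x :: "nat \<Rightarrow> 'a \<Rightarrow> real"
  assumes "finite Y" "\<And>k s. s \<in> Y \<Longrightarrow> \<bar>x k s\<bar> \<le> M s"
  shows "\<exists>r l. strict_mono (r :: nat \<Rightarrow> nat) \<and> (\<forall>s\<in>Y. (\<lambda>k. x (r k) s) \<longlonglongrightarrow> l s)"
  using assms
proof (induction Y rule: finite_induct)
  case empty
  then show ?case by (intro exI[of _ id]) (auto simp: strict_mono_def)
next
  case (insert a Y)
  then obtain r l where r: "strict_mono (r :: nat \<Rightarrow> nat)" "\<forall>s\<in>Y. (\<lambda>k. x (r k) s) \<longlonglongrightarrow> l s"
    by auto
  have "bounded (range (\<lambda>k. x (r k) a))"
    using insert.prems[of a] by (auto simp: bounded_iff intro!: exI[of _ "M a"])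
  then obtain L r' where r': "strict_mono r'" "((\<lambda>k. x (r k) a) \<circ> r') \<longlonglongrightarrow> L"
    using bounded_imp_convergent_subsequence by blast
  show ?case
  proof (intro exI conjI ballI)
    show "strict_mono (r \<circ> r')" using r(1) r'(1) by (rule strict_mono_o)
    show "(\<lambda>k. x ((r \<circ> r') k) s) \<longlonglongrightarrow> (l(a := L)) s" if "s \<in> insert a Y" for s
    proof (cases "s = a")
      case True then show ?thesis using r' by (simp add: o_def)
    next
      case False
      then have "(\<lambda>k. x (r k) s) \<longlonglongrightarrow> l s" using r that by auto
      then show ?thesis using LIMSEQ_subseq_LIMSEQ[OF _ r'(1)] False by (fastforce simp: o_def)
    qed
  qed
qed

text \<open>Apply \<open>ln x \<le> x - 1\<close> at \<open>x = sqrt (b / p)\<close>; the square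
  root leaves a Hellinger-type square as a quantitative remainder. For \<open>p = 0\<close> the
  factor \<open>p\<close> annihilates the logarithms.\<close>

lemma relative_entropy_term_ge:
  fixes p b :: real
  assumes "0 \<le> p" "0 < b"
  shows "(sqrt p - sqrt b)\<^sup>2 + p - b \<le> p * (ln p - ln b)"
proof (cases "p = 0")
  case True then show ?thesis using assms by simp
next
  case False
  then have p: "p > 0" using assms by simp
  have "(ln b - ln p) / 2 = ln (sqrt (b / p))" using p assms by (simp add: ln_sqrt ln_div)
  also have "\<dots> \<le> sqrt (b / p) - 1" using p assms by (intro ln_le_minus_one) simp
  finally have "ln b - ln p \<le> 2 * (sqrt (b / p) - 1)" by simp
  then have "p * (ln b - ln p) \<le> p * (2 * (sqrt (b / p) - 1))" using p by (intro mult_left_mono) auto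
  moreover have "p * sqrt (b / p) = sqrt p * sqrt b"
    using p by (simp add: real_sqrt_divide field_simps)
  ultimately show ?thesis using assms p
    by (simp add: power2_diff algebra_simps)
qed

lemma relative_entropy_ge:
  fixes p b :: "'a \<Rightarrow> real"
  assumes "finite U" "\<And>s. s \<in> U \<Longrightarrow> 0 \<le> p s" "\<And>s. s \<in> U \<Longrightarrow> 0 < b s" "sum b U \<le> sum p U"
  shows "(\<Sum>s\<in>U. (sqrt (p s) - sqrt (b s))\<^sup>2) \<le> (\<Sum>s\<in>U. p s * (ln (p s) - ln (b s)))"
proof -
  have "(\<Sum>s\<in>U. (sqrt (p s) - sqrt (b s))\<^sup>2 + p s - b s) \<le> (\<Sum>s\<in>U. p s * (ln (p s) - ln (b s)))"
    by (intro sum_mono relative_entropy_term_ge assms)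
  then show ?thesis using assms(4) by (simp add: sum.distrib sum_subtractf)
qed

text \<open>A Farkas-type argument that produces a Lagrange multiplier \<open>t\<close>. The vector
  \<open>l\<close> forces \<open>\<mu>\<close> to be nonzero; directions close to the component of
  \<open>\<xi>\<close> orthogonal to \<open>\<mu>\<close> show that this component is zero, and the
  direction \<open>- \<mu>\<close> fixes the sign.\<close>

lemma halfspace_inclusion_imp_parallel:
  fixes \<mu> \<xi> l :: "'a \<Rightarrow> real"
  assumes B: "finite B" and l: "(\<Sum>b\<in>B. l b * \<mu> b) > 0" and \<xi>: "(\<Sum>b\<in>B. (\<xi> b)\<^sup>2) = 1"
    and incl: "\<And>h. (\<Sum>b\<in>B. h b * \<mu> b) < 0 \<Longrightarrow> (\<Sum>b\<in>B. \<xi> b * h b) \<le> 0"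
  shows "\<exists>t>0. \<forall>b\<in>B. \<mu> b = t * \<xi> b"
proof -
  define sq where "sq = (\<Sum>b\<in>B. \<mu> b * \<mu> b)"
  have "\<exists>b\<in>B. \<mu> b \<noteq> 0" using l by (metis (no_types, lifting) less_irrefl mult_zero_right sum.neutral)
  then obtain b0 where "b0 \<in> B" "\<mu> b0 \<noteq> 0" by blast
  then have sq: "sq > 0" unfolding sq_def using B by (intro sum_pos2[of B b0]) (auto simp: zero_less_mult_iff)
  define a where "a = (\<Sum>b\<in>B. \<xi> b * \<mu> b) / sq"
  have a_sq: "a * sq = (\<Sum>b\<in>B. \<xi> b * \<mu> b)" using sq by (simp add: a_def)
  define h0 where "h0 b = \<xi> b - a * \<mu> b" for b
  have h0\<mu>: "(\<Sum>b\<in>B. h0 b * \<mu> b) = 0"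
  proof -
    have "(\<Sum>b\<in>B. h0 b * \<mu> b) = (\<Sum>b\<in>B. \<xi> b * \<mu> b) - a * sq"
      unfolding h0_def sq_def by (simp add: left_diff_distrib sum_subtractf sum_distrib_left mult.assoc)
    then show ?thesis using a_sq by simp
  qed
  have \<xi>h0: "(\<Sum>b\<in>B. \<xi> b * h0 b) = (\<Sum>b\<in>B. (h0 b)\<^sup>2)"
  proof -
    have "(\<Sum>b\<in>B. \<xi> b * h0 b) = (\<Sum>b\<in>B. (h0 b)\<^sup>2 + a * (h0 b * \<mu> b))"
      by (rule sum.cong) (auto simp: h0_def power2_eq_square algebra_simps)
    also have "\<dots> = (\<Sum>b\<in>B. (h0 b)\<^sup>2)" using h0\<mu> by (simp add: sum.distrib flip: sum_distrib_left)
    finally show ?thesis .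
  qed
  \<comment> \<open>\<open>h0\<close> lies on the boundary of the half-space; subtracting
    \<open>\<epsilon> * \<mu>\<close> moves it inside, at a cost that vanishes with
    \<open>\<epsilon>\<close>.\<close>
  have le: "(\<Sum>b\<in>B. (h0 b)\<^sup>2) \<le> \<epsilon> * (a * sq)" if "\<epsilon> > 0" for \<epsilon>
  proof -
    have "(\<Sum>b\<in>B. (h0 b - \<epsilon> * \<mu> b) * \<mu> b) = - \<epsilon> * sq"
      using h0\<mu> by (simp add: left_diff_distrib sum_subtractf sum_distrib_left mult.assoc sq_def sum_negf)
    also have "\<dots> < 0" using that sq by simp
    finally have "(\<Sum>b\<in>B. \<xi> b * (h0 b - \<epsilon> * \<mu> b)) \<le> 0" by (rule incl)
    moreover have "(\<Sum>b\<in>B. \<xi> b * (h0 b - \<epsilon> * \<mu> b)) = (\<Sum>b\<in>B. \<xi> b * h0 b) - \<epsilon> * (a * sq)"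
      unfolding a_sq by (simp add: right_diff_distrib sum_subtractf sum_distrib_left mult.left_commute)
    ultimately show ?thesis using \<xi>h0 by simp
  qed
  have "((\<lambda>\<epsilon>. \<epsilon> * (a * sq)) \<longlongrightarrow> 0 * (a * sq)) (at_right 0)" by (intro tendsto_intros)
  then have "(\<Sum>b\<in>B. (h0 b)\<^sup>2) \<le> 0 * (a * sq)"
    by (rule tendsto_lowerbound) (auto simp: le eventually_at_right_less intro: eventually_mono[OF eventually_at_right_less])
  then have "(\<Sum>b\<in>B. (h0 b)\<^sup>2) = 0" by (simp add: antisym sum_nonneg)
  then have h00: "\<xi> b = a * \<mu> b" if "b \<in> B" for b
    using B that by (simp add: sum_nonneg_eq_0_iff h0_def)
  have "(\<Sum>b\<in>B. - \<mu> b * \<mu> b) < 0" using sq by (simp add: sq_def sum_negf)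
  then have "(\<Sum>b\<in>B. \<xi> b * - \<mu> b) \<le> 0" by (rule incl)
  then have "a * sq \<ge> 0" unfolding a_sq by (simp add: sum_negf)
  then have "a \<ge> 0" using sq by (simp add: zero_le_mult_iff)
  moreover have "a \<noteq> 0"
  proof
    assume "a = 0"
    then have "(\<Sum>b\<in>B. (\<xi> b)\<^sup>2) = 0" using h00 by simp
    then show False using \<xi> by simp
  qed
  ultimately have "a > 0" by simp
  then show ?thesis using h00 by (intro exI[of _ "1 / a"]) auto
qed

section \<open>The space of homomorphisms in coordinates\<close>

text \<open>The group is left behind here: \<open>A b s\<close> stands for the value at the
  generator \<open>s\<close> of the homomorphism dual to \<open>b\<close>, and \<open>neg_A\<close>
  records that the inverse of \<open>s\<close> is a word in which \<open>t\<close> occurs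
  \<open>m s t\<close> times.\<close>

locale positively_spanning_system =
  fixes Y B :: "'a set" and A m :: "'a \<Rightarrow> 'a \<Rightarrow> real" and F :: "'a \<Rightarrow> real"
  assumes finite_Y: "finite Y" and B_subset: "B \<subseteq> Y" 
    and dual: "\<And>b b'. b \<in> B \<Longrightarrow> b' \<in> B \<Longrightarrow> A b b' = (if b' = b then 1 else 0)"
    and F_pos: "\<And>s. s \<in> Y \<Longrightarrow> F s > 0"
    and m_nonneg: "\<And>s t. 0 \<le> m s t"
    and neg_A: "\<And>b s. b \<in> B \<Longrightarrow> s \<in> Y \<Longrightarrow> - A b s = (\<Sum>t\<in>Y. m s t * A b t)"
begin

lemma finite_B: "finite B"
  using finite_Y B_subset by (rule finite_subset[rotated])

text \<open>Only the values on \<open>Y\<close> are constrained. There the functions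
  \<open>A b\<close> form a basis, and the coordinates of \<open>c\<close> are its values on
  \<open>B\<close>.\<close>

definition W :: "('a \<Rightarrow> real) set"
  where "W = {c. \<forall>s\<in>Y. c s = (\<Sum>b\<in>B. c b * A b s)}"

lemma W_add: "c \<in> W \<Longrightarrow> d \<in> W \<Longrightarrow> (\<lambda>s. c s + d s) \<in> W"
  by (auto simp: W_def distrib_right sum.distrib)

lemma W_scale: "c \<in> W \<Longrightarrow> (\<lambda>s. x * c s) \<in> W"
  by (auto simp: W_def mult.assoc sum_distrib_left[symmetric])

lemma W_diff: "c \<in> W \<Longrightarrow> d \<in> W \<Longrightarrow> (\<lambda>s. c s - d s) \<in> W"
  by (auto simp: W_def left_diff_distrib sum_subtractf)

lemma W_zero: "(\<lambda>_. 0) \<in> W"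
  by (auto simp: W_def)

text \<open>By \<open>dual\<close> this is the element of the space with arbitrarily prescribed
  values \<open>h\<close> on \<open>B\<close>.\<close>

definition W_ext :: "('a \<Rightarrow> real) \<Rightarrow> 'a \<Rightarrow> real"
  where "W_ext h s = (\<Sum>b\<in>B. h b * A b s)"

lemma W_ext_basis: "b \<in> B \<Longrightarrow> W_ext h b = h b"
proof -
  assume b: "b \<in> B"
  have "W_ext h b = (\<Sum>b'\<in>B. if b' = b then h b' else 0)"
    unfolding W_ext_def by (rule sum.cong) (use b dual in auto)
  then show ?thesis using b finite_B by simp
qed

lemma W_ext_in_W: "W_ext h \<in> W"
  unfolding W_def using W_ext_basis by (auto simp: W_ext_def)

lemma W_neg:
  assumes "c \<in> W" "s \<in> Y"
  shows "- c s = (\<Sum>t\<in>Y. m s t * c t)"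
proof -
  have "- c s = (\<Sum>b\<in>B. c b * - A b s)" using assms by (simp add: W_def sum_negf)
  also have "\<dots> = (\<Sum>b\<in>B. c b * (\<Sum>t\<in>Y. m s t * A b t))" using neg_A assms by (intro sum.cong) auto
  also have "\<dots> = (\<Sum>t\<in>Y. \<Sum>b\<in>B. c b * (m s t * A b t))"
    unfolding sum_distrib_left by (rule sum.swap)
  also have "\<dots> = (\<Sum>t\<in>Y. m s t * (\<Sum>b\<in>B. c b * A b t))"
    by (simp add: sum_distrib_left mult.left_commute)
  also have "\<dots> = (\<Sum>t\<in>Y. m s t * c t)" using assms by (simp add: W_def)
  finally show ?thesis .
qed

text \<open>Positive spanning becomes compactness here: \<open>W_neg\<close> bounds
  \<open>- c s\<close> above by a nonnegative combination of the upper bounds, so upper bounds on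
  \<open>Y\<close> imply lower ones.\<close>

lemma W_abs_le:
  assumes "c \<in> W" "\<And>t. t \<in> Y \<Longrightarrow> c t \<le> M t" "\<And>t. t \<in> Y \<Longrightarrow> 0 \<le> M t" "s \<in> Y"
  shows "\<bar>c s\<bar> \<le> M s + (\<Sum>t\<in>Y. m s t * M t)"
proof -
  have "- c s \<le> (\<Sum>t\<in>Y. m s t * M t)"
    unfolding W_neg[OF assms(1,4)] by (intro sum_mono mult_left_mono) (auto simp: assms m_nonneg)
  moreover have "0 \<le> (\<Sum>t\<in>Y. m s t * M t)" by (intro sum_nonneg mult_nonneg_nonneg) (auto simp: assms m_nonneg)
  ultimately show ?thesis using assms(2)[of s] assms(3)[of s] assms(4) by auto
qed

lemma W_limit:
  assumes "\<And>k. c k \<in> W" "\<And>s. s \<in> Y \<Longrightarrow> (\<lambda>k. c k s) \<longlonglongrightarrow> l s"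
  shows "l \<in> W"
  unfolding W_def
proof (intro CollectI ballI)
  fix s assume s: "s \<in> Y"
  have "(\<lambda>k. \<Sum>b\<in>B. c k b * A b s) \<longlonglongrightarrow> (\<Sum>b\<in>B. l b * A b s)"
    using assms(2) B_subset by (intro tendsto_sum tendsto_mult_right) auto
  moreover have "(\<lambda>k. \<Sum>b\<in>B. c k b * A b s) = (\<lambda>k. c k s)" using assms(1) s by (auto simp: W_def)
  ultimately show "l s = (\<Sum>b\<in>B. l b * A b s)" using assms(2)[OF s] by (metis LIMSEQ_unique)
qed

lemma W_bounded_subsequence:
  assumes "\<And>k. c k \<in> W" "\<And>k t. t \<in> Y \<Longrightarrow> c k t \<le> M t" "\<And>t. t \<in> Y \<Longrightarrow> 0 \<le> M t"
  shows "\<exists>r l. strict_mono (r :: nat \<Rightarrow> nat) \<and> l \<in> W \<and> (\<forall>s\<in>Y. (\<lambda>k. c (r k) s) \<longlonglongrightarrow> l s)"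
proof -
  have "\<bar>c k s\<bar> \<le> M s + (\<Sum>t\<in>Y. m s t * M t)" if "s \<in> Y" for k s
    by (rule W_abs_le) (use assms that in auto)
  then obtain r l where "strict_mono (r :: nat \<Rightarrow> nat)" "\<forall>s\<in>Y. (\<lambda>k. c (r k) s) \<longlonglongrightarrow> l s"
    using finite_coordinates_subsequence[OF finite_Y, of c "\<lambda>s. M s + (\<Sum>t\<in>Y. m s t * M t)"] by blast
  with W_limit[of "\<lambda>k. c (r k)" l] assms(1) show ?thesis by blast
qed

text \<open>The functional \<mu>(p) of the introduction, evaluated at the basis element
  \<open>A b\<close>.\<close>

definition moment :: "('a \<Rightarrow> real) \<Rightarrow> 'a \<Rightarrow> real"
  where "moment p b = (\<Sum>s\<in>Y. p s * A b s)"

lemma W_pairing: 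
  assumes "c \<in> W" shows "(\<Sum>s\<in>Y. p s * c s) = (\<Sum>b\<in>B. c b * moment p b)"
proof -
  have "(\<Sum>s\<in>Y. p s * c s) = (\<Sum>s\<in>Y. \<Sum>b\<in>B. p s * (c b * A b s))"
    by (rule sum.cong) (use assms in \<open>auto simp: W_def sum_distrib_left\<close>)
  also have "\<dots> = (\<Sum>b\<in>B. \<Sum>s\<in>Y. p s * (c b * A b s))" by (rule sum.swap)
  also have "\<dots> = (\<Sum>b\<in>B. c b * moment p b)"
    by (simp add: moment_def sum_distrib_left mult.left_commute)
  finally show ?thesis .
qed

definition partition_fun :: "real \<Rightarrow> ('a \<Rightarrow> real) \<Rightarrow> real"
  where "partition_fun \<beta> c = (\<Sum>s\<in>Y. exp (c s - \<beta> * F s))"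

text \<open>A sequential form of the limit set, with one index \<open>k\<close> controlling both the
  size of \<open>\<beta>\<close> and the closeness. \<open>gibbs_limit_eq_limit_set\<close>
  identifies it with the intersection of closures.\<close>

definition limit_set :: "('a \<Rightarrow> real) set"
  where "limit_set = {p \<in> Delta Y. \<forall>k::nat. \<exists>\<beta>\<ge>real k. \<exists>c\<in>W. partition_fun \<beta> c = 1 \<and>
    (\<forall>s\<in>Y. \<bar>exp (c s - \<beta> * F s) - p s\<bar> < 1 / (real k + 1))}"

lemma exponent_le_0:
  assumes "partition_fun \<beta> c \<le> 1" "s \<in> Y"
  shows "c s \<le> \<beta> * F s"
proof -
  have "exp (c s - \<beta> * F s) \<le> partition_fun \<beta> c"
    unfolding partition_fun_def by (rule member_le_sum) (use assms finite_Y in auto)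
  then have "exp (c s - \<beta> * F s) \<le> 1" using assms(1) by (rule order.trans)
  then show ?thesis by simp
qed

text \<open>\<open>x\<close> is a limit of \<open>c/\<beta>\<close>. On the tight coordinates \<open>x = F\<close> the exponent \<open>c - \<beta> F\<close> agrees
  with \<open>u = c - \<beta> x\<close>, which lies in \<open>W\<close>; off them the weight tends to \<open>0\<close>.\<close>

lemma limit_set_tight_face:
  assumes p: "p \<in> limit_set"
  shows "\<exists>x\<in>W. \<exists>u. (\<forall>s\<in>Y. x s \<le> F s) \<and> (\<forall>s\<in>Y. p s \<noteq> 0 \<longrightarrow> x s = F s) \<and>
    (\<forall>k::nat. u k \<in> W \<and> (\<Sum>s | s \<in> Y \<and> x s = F s. exp (u k s)) \<le> 1) \<and>
    (\<forall>s\<in>Y. x s = F s \<longrightarrow> (\<lambda>k. exp (u k s)) \<longlonglongrightarrow> p s)"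
proof -
  \<comment> \<open>The shift to \<open>Suc k\<close> keeps \<open>\<beta>\<close> positive, so that
    it can be divided by.\<close>
  have "\<forall>k. \<exists>\<beta> c. \<beta> \<ge> real (Suc k) \<and> c \<in> W \<and> partition_fun \<beta> c = 1 \<and>
    (\<forall>s\<in>Y. \<bar>exp (c s - \<beta> * F s) - p s\<bar> < 1 / (real (Suc k) + 1))"
    using p unfolding limit_set_def by blast
  then obtain \<beta> c where \<beta>: "\<And>k. \<beta> k \<ge> real (Suc k)" and c: "\<And>k. c k \<in> W" "\<And>k. partition_fun (\<beta> k) (c k) = 1"
    and near: "\<And>k s. s \<in> Y \<Longrightarrow> \<bar>exp (c k s - \<beta> k * F s) - p s\<bar> < 1 / (real (Suc k) + 1)"
    by metis
  have \<beta>_pos: "\<beta> k > 0" for k using \<beta>[of k] by simp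
  have \<beta>_top: "filterlim \<beta> at_top sequentially"
    by (rule filterlim_at_top_mono[OF filterlim_real_sequentially])
      (use \<beta> in \<open>auto intro!: always_eventually order.trans[OF _ \<beta>]\<close>)
  have lim: "(\<lambda>k. exp (c k s - \<beta> k * F s)) \<longlonglongrightarrow> p s" if "s \<in> Y" for s
  proof -
    have "(\<lambda>k. exp (c k s - \<beta> k * F s) - p s) \<longlonglongrightarrow> 0"
    proof (rule Lim_null_comparison)
      show "\<forall>\<^sub>F k in sequentially. norm (exp (c k s - \<beta> k * F s) - p s) \<le> 1 / (real (Suc k) + 1)"
        using near[OF that] by (intro always_eventually allI) (simp only: real_norm_def less_imp_le)
      show "(\<lambda>k. 1 / (real (Suc k) + 1)) \<longlonglongrightarrow> 0" 
        using LIMSEQ_Suc[OF LIMSEQ_inverse_real_of_nat] by (simp add: inverse_eq_divide add.commute)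
    qed
    then show ?thesis by (simp add: LIM_zero_iff)
  qed
  \<comment> \<open>Division by \<open>\<beta>\<close> turns the bound of \<open>c\<close> by
    \<open>\<beta> * F\<close> into a bound by \<open>F\<close>, uniform in \<open>k\<close>, and
    compactness applies.\<close>
  define y where "y k s = (1 / \<beta> k) * c k s" for k s
  have "y k \<in> W" for k unfolding y_def by (rule W_scale) (rule c)
  moreover have "y k t \<le> F t" if "t \<in> Y" for k t
    using exponent_le_0[of "\<beta> k" "c k" t] c that \<beta>_pos[of k] by (simp add: y_def field_simps)
  ultimately obtain r x where r: "strict_mono (r :: nat \<Rightarrow> nat)" and x: "x \<in> W"
    and x_lim: "\<And>s. s \<in> Y \<Longrightarrow> (\<lambda>k. y (r k) s) \<longlonglongrightarrow> x s"
    using W_bounded_subsequence[of y F] F_pos by (metis less_imp_le)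
  have x_le: "x s \<le> F s" if "s \<in> Y" for s
    using x_lim[OF that] by (rule LIMSEQ_le_const2) (use \<open>\<And>k t. t \<in> Y \<Longrightarrow> y k t \<le> F t\<close> that in auto)
  have supp: "x s = F s" if s: "s \<in> Y" and ps: "p s \<noteq> 0" for s
  proof (rule ccontr)
    assume "x s \<noteq> F s"
    then have neg: "x s - F s < 0" using x_le[OF s] by simp
    have "(\<lambda>k. y (r k) s - F s) \<longlonglongrightarrow> x s - F s" using x_lim[OF s] by (intro tendsto_intros)
    moreover have "filterlim (\<lambda>k. \<beta> (r k)) at_top sequentially"
      using filterlim_compose[OF \<beta>_top filterlim_subseq[OF r]] .
    ultimately have "filterlim (\<lambda>k. (y (r k) s - F s) * \<beta> (r k)) at_bot sequentially"
      using neg by (intro filterlim_tendsto_neg_mult_at_bot)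
    moreover have "(y (r k) s - F s) * \<beta> (r k) = c (r k) s - \<beta> (r k) * F s" for k
      using \<beta>_pos[of "r k"] by (simp add: y_def field_simps)
    ultimately have "filterlim (\<lambda>k. c (r k) s - \<beta> (r k) * F s) at_bot sequentially" by simp
    then have "(\<lambda>k. exp (c (r k) s - \<beta> (r k) * F s)) \<longlonglongrightarrow> 0"
      by (rule filterlim_compose[OF exp_at_bot])
    moreover have "(\<lambda>k. exp (c (r k) s - \<beta> (r k) * F s)) \<longlonglongrightarrow> p s"
      using LIMSEQ_subseq_LIMSEQ[OF lim[OF s] r] by (simp add: o_def)
    ultimately show False using ps LIMSEQ_unique by blast
  qed
  define u where "u k s = c (r k) s - \<beta> (r k) * x s" for k s
  have "u k \<in> W" for k unfolding u_def by (intro W_diff W_scale c x)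
  moreover have "(\<Sum>s | s \<in> Y \<and> x s = F s. exp (u k s)) \<le> 1" for k
  proof -
    have "(\<Sum>s | s \<in> Y \<and> x s = F s. exp (u k s)) = (\<Sum>s | s \<in> Y \<and> x s = F s. exp (c (r k) s - \<beta> (r k) * F s))"
      by (rule sum.cong) (auto simp: u_def)
    also have "\<dots> \<le> partition_fun (\<beta> (r k)) (c (r k))"
      unfolding partition_fun_def by (rule sum_mono2) (use finite_Y in auto)
    finally show ?thesis using c by simp
  qed
  moreover have "(\<lambda>k. exp (u k s)) \<longlonglongrightarrow> p s" if "s \<in> Y" "x s = F s" for s
    using LIMSEQ_subseq_LIMSEQ[OF lim[OF that(1)] r] that by (simp add: o_def u_def)
  ultimately show ?thesis using x x_le supp by (intro bexI[of _ x] exI[of _ u]) auto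
qed

section \<open>Injectivity of the moment direction\<close>

lemma limit_set_sum: "p \<in> limit_set \<Longrightarrow> sum p Y = 1"
  and limit_set_nonneg: "p \<in> limit_set \<Longrightarrow> s \<in> Y \<Longrightarrow> 0 \<le> p s"
  by (auto simp: limit_set_def Delta_def)

text \<open>Pair with the element \<open>x\<close> of the tight face: since \<open>x = F\<close>
  wherever \<open>p\<close> is nonzero, the pairing is the \<open>p\<close>-average of
  \<open>F\<close>, which is positive.\<close>

lemma moment_nonzero:
  assumes p: "p \<in> limit_set"
  shows "\<exists>b\<in>B. moment p b \<noteq> 0"
proof (rule ccontr)
  assume 0: "\<not> (\<exists>b\<in>B. moment p b \<noteq> 0)"
  obtain x where x: "x \<in> W" "\<And>s. s \<in> Y \<Longrightarrow> p s \<noteq> 0 \<Longrightarrow> x s = F s"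
    using limit_set_tight_face[OF p] by blast
  have "(\<Sum>s\<in>Y. p s * F s) = (\<Sum>s\<in>Y. p s * x s)" using x(2) by (intro sum.cong) force+
  also have "\<dots> = 0" using W_pairing[OF x(1)] 0 by simp
  finally have "\<forall>s\<in>Y. p s * F s = 0"
    using finite_Y limit_set_nonneg[OF p] F_pos by (subst (asm) sum_nonneg_eq_0_iff) (auto simp: less_imp_le)
  then have "\<forall>s\<in>Y. p s = 0" using F_pos by force
  then show False using limit_set_sum[OF p] by simp
qed

text \<open>The entropies are taken relative to the approximants \<open>exp (u k s)\<close> and
  \<open>exp (v k s)\<close>, which stay positive even where the limits \<open>q\<close> and
  \<open>p\<close> vanish.\<close>

lemma moment_ray_injective:
  assumes p: "p \<in> limit_set" and q: "q \<in> limit_set" and t: "t > 0"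
    and pq: "\<And>b. b \<in> B \<Longrightarrow> moment p b = t * moment q b"
    and s0: "s0 \<in> Y"
  shows "p s0 = q s0"
proof -
  have pair: "(\<Sum>s\<in>Y. p s * c s) = t * (\<Sum>s\<in>Y. q s * c s)" if "c \<in> W" for c
    using pq by (simp add: W_pairing[OF that] sum_distrib_left mult.left_commute)
  obtain x u where x: "x \<in> W" "\<And>s. s \<in> Y \<Longrightarrow> x s \<le> F s" "\<And>s. s \<in> Y \<Longrightarrow> p s \<noteq> 0 \<Longrightarrow> x s = F s"
    and u: "\<And>k::nat. u k \<in> W" "\<And>k. (\<Sum>s | s \<in> Y \<and> x s = F s. exp (u k s)) \<le> 1"
      "\<And>s. s \<in> Y \<Longrightarrow> x s = F s \<Longrightarrow> (\<lambda>k. exp (u k s)) \<longlonglongrightarrow> p s"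
    using limit_set_tight_face[OF p] by blast
  obtain y v where y: "y \<in> W" "\<And>s. s \<in> Y \<Longrightarrow> y s \<le> F s" "\<And>s. s \<in> Y \<Longrightarrow> q s \<noteq> 0 \<Longrightarrow> y s = F s"
    and v: "\<And>k::nat. v k \<in> W" "\<And>k. (\<Sum>s | s \<in> Y \<and> y s = F s. exp (v k s)) \<le> 1"
      "\<And>s. s \<in> Y \<Longrightarrow> y s = F s \<Longrightarrow> (\<lambda>k. exp (v k s)) \<longlonglongrightarrow> q s"
    using limit_set_tight_face[OF q] by blast
  have px: "(\<Sum>s\<in>Y. p s * x s) = (\<Sum>s\<in>Y. p s * F s)"
    using x by (intro sum.cong) auto
  have qy: "(\<Sum>s\<in>Y. q s * y s) = (\<Sum>s\<in>Y. q s * F s)"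
    using y by (intro sum.cong) auto
  have qx: "(\<Sum>s\<in>Y. q s * x s) \<le> (\<Sum>s\<in>Y. q s * F s)"
    using x limit_set_nonneg[OF q] by (intro sum_mono mult_left_mono) auto
  have py: "(\<Sum>s\<in>Y. p s * y s) \<le> (\<Sum>s\<in>Y. p s * F s)"
    using y limit_set_nonneg[OF p] by (intro sum_mono mult_left_mono) auto
  \<comment> \<open>With a dot for the sum over \<open>Y\<close>: p.F = p.x = t q.x \<le> t q.F = t
    q.y = p.y \<le> p.F, so equality holds throughout.\<close>
  have "t * (\<Sum>s\<in>Y. q s * x s) \<le> t * (\<Sum>s\<in>Y. q s * F s)" using qx t by simp
  then have qx': "(\<Sum>s\<in>Y. q s * x s) = (\<Sum>s\<in>Y. q s * F s)" and py': "(\<Sum>s\<in>Y. p s * y s) = (\<Sum>s\<in>Y. p s * F s)"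
    using pair[OF x(1)] pair[OF y(1)] px qy py t by auto
  have "(\<Sum>s\<in>Y. q s * (F s - x s)) = 0" using qx' by (simp add: right_diff_distrib sum_subtractf)
  then have q_supp: "\<forall>s\<in>Y. q s * (F s - x s) = 0"
    using finite_Y limit_set_nonneg[OF q] x(2) by (subst (asm) sum_nonneg_eq_0_iff) auto
  have "(\<Sum>s\<in>Y. p s * (F s - y s)) = 0" using py' by (simp add: right_diff_distrib sum_subtractf)
  then have p_supp: "\<forall>s\<in>Y. p s * (F s - y s) = 0"
    using finite_Y limit_set_nonneg[OF p] y(2) by (subst (asm) sum_nonneg_eq_0_iff) auto
  \<comment> \<open>Both limits vanish off \<open>U\<close>: nonzero weight forces tightness for its
    own element, and the equalities above force it for the other.\<close>
  define U where "U = {s \<in> Y. x s = F s \<and> y s = F s}"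
  have U: "finite U" "U \<subseteq> Y" using finite_Y by (auto simp: U_def)
  have pU: "p s = 0" if "s \<in> Y - U" for s
    using that x(3)[of s] bspec[OF p_supp, of s] by (auto simp: U_def)
  have qU: "q s = 0" if "s \<in> Y - U" for s
    using that y(3)[of s] bspec[OF q_supp, of s] by (auto simp: U_def)
  have sumU: "(\<Sum>s\<in>Y. f s) = (\<Sum>s\<in>U. f s)" if "\<And>s. s \<in> Y - U \<Longrightarrow> f s = 0" for f :: "'a \<Rightarrow> real"
    using that finite_Y U by (intro sum.mono_neutral_right) auto
  have sump: "sum p U = 1" and sumq: "sum q U = 1"
    using sumU[of p, OF pU] sumU[of q, OF qU] limit_set_sum[OF p] limit_set_sum[OF q] by simp_all
  have sumv: "(\<Sum>s\<in>U. exp (v k s)) \<le> sum p U" for k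
  proof -
    have "(\<Sum>s\<in>U. exp (v k s)) \<le> (\<Sum>s | s \<in> Y \<and> y s = F s. exp (v k s))"
      by (rule sum_mono2) (use finite_Y in \<open>auto simp: U_def\<close>)
    then show ?thesis using v(2)[of k] sump by simp
  qed
  have sumu: "(\<Sum>s\<in>U. exp (u k s)) \<le> sum q U" for k
  proof -
    have "(\<Sum>s\<in>U. exp (u k s)) \<le> (\<Sum>s | s \<in> Y \<and> x s = F s. exp (u k s))"
      by (rule sum_mono2) (use finite_Y in \<open>auto simp: U_def\<close>)
    then show ?thesis using u(2)[of k] sumq by simp
  qed
  \<comment> \<open>Each limit is compared with the approximants of the other one.\<close>
  define D1 where "D1 k = (\<Sum>s\<in>U. p s * (ln (p s) - v k s))" for k
  define D2 where "D2 k = (\<Sum>s\<in>U. q s * (ln (q s) - u k s))" for k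
  have D1: "(\<Sum>s\<in>U. (sqrt (p s) - sqrt (exp (v k s)))\<^sup>2) \<le> D1 k" for k
    using relative_entropy_ge[OF U(1), of p "\<lambda>s. exp (v k s)"] sumv[of k] U(2) limit_set_nonneg[OF p]
    by (auto simp: D1_def)
  have "(\<Sum>s\<in>U. (sqrt (q s) - sqrt (exp (u k s)))\<^sup>2) \<le> D2 k" for k
    using relative_entropy_ge[OF U(1), of q "\<lambda>s. exp (u k s)"] sumu[of k] U(2) limit_set_nonneg[OF q]
    by (auto simp: D2_def)
  then have D2: "0 \<le> D2 k" for k by (meson order.trans sum_nonneg zero_le_power2)
  \<comment> \<open>Since \<open>u k - v k\<close> lies in \<open>W\<close>, the pairing identity
    exchanges the approximants. On the right each limit meets its own approximants, and the
    expression tends to 0.\<close>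
  have D12: "D1 k + t * D2 k = (\<Sum>s\<in>U. p s * (ln (p s) - u k s)) + t * (\<Sum>s\<in>U. q s * (ln (q s) - v k s))" for k
  proof -
    have "(\<Sum>s\<in>Y. p s * (u k s - v k s)) = t * (\<Sum>s\<in>Y. q s * (u k s - v k s))"
      by (rule pair) (intro W_diff u v)
    then have "(\<Sum>s\<in>U. p s * (u k s - v k s)) = t * (\<Sum>s\<in>U. q s * (u k s - v k s))"
      using sumU[of "\<lambda>s. p s * (u k s - v k s)"] sumU[of "\<lambda>s. q s * (u k s - v k s)"] pU qU by simp
    then show ?thesis
      by (simp add: D1_def D2_def right_diff_distrib sum_subtractf)
  qed
  have lim_p: "(\<lambda>k. \<Sum>s\<in>U. p s * (ln (p s) - u k s)) \<longlonglongrightarrow> (\<Sum>s\<in>U. p s * (ln (p s) - ln (p s)))"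
  proof (intro tendsto_sum)
    fix s assume s: "s \<in> U"
    show "(\<lambda>k. p s * (ln (p s) - u k s)) \<longlonglongrightarrow> p s * (ln (p s) - ln (p s))"
    \<comment> \<open>Where \<open>p s = 0\<close> the term is identically zero, although
      \<open>u k s\<close> tends to minus infinity.\<close>
    proof (cases "p s = 0")
      case False
      have "(\<lambda>k. ln (exp (u k s))) \<longlonglongrightarrow> ln (p s)"
        using u(3)[of s] s False by (intro tendsto_ln) (auto simp: U_def)
      then show ?thesis by (intro tendsto_intros) simp
    qed simp
  qed
  have lim_q: "(\<lambda>k. \<Sum>s\<in>U. q s * (ln (q s) - v k s)) \<longlonglongrightarrow> (\<Sum>s\<in>U. q s * (ln (q s) - ln (q s)))"
  proof (intro tendsto_sum)
    fix s assume s: "s \<in> U"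
    show "(\<lambda>k. q s * (ln (q s) - v k s)) \<longlonglongrightarrow> q s * (ln (q s) - ln (q s))"
    proof (cases "q s = 0")
      case False
      have "(\<lambda>k. ln (exp (v k s))) \<longlonglongrightarrow> ln (q s)"
        using v(3)[of s] s False by (intro tendsto_ln) (auto simp: U_def)
      then show ?thesis by (intro tendsto_intros) simp
    qed simp
  qed
  have "(\<lambda>k. D1 k + t * D2 k) \<longlonglongrightarrow> 0"
    unfolding D12 using tendsto_add[OF lim_p tendsto_mult_left[OF lim_q, of t]] by simp
  show ?thesis
  proof (cases "s0 \<in> U")
    case False then show ?thesis using pU qU s0 by simp
  next
    case True
    \<comment> \<open>As \<open>D2 k\<close> is nonnegative, \<open>D1 k\<close> is squeezed to 0,
      so the approximants of \<open>q\<close> also converge to \<open>p\<close>.\<close>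
    have "(\<lambda>k. (sqrt (p s0) - sqrt (exp (v k s0)))\<^sup>2) \<longlonglongrightarrow> 0"
    proof (rule Lim_null_comparison[OF _ \<open>(\<lambda>k. D1 k + t * D2 k) \<longlonglongrightarrow> 0\<close>], intro always_eventually allI)
      fix k
      have "(sqrt (p s0) - sqrt (exp (v k s0)))\<^sup>2 \<le> (\<Sum>s\<in>U. (sqrt (p s) - sqrt (exp (v k s)))\<^sup>2)"
        by (rule member_le_sum[OF True]) (use U in auto)
      also have "\<dots> \<le> D1 k" by (rule D1)
      also have "\<dots> \<le> D1 k + t * D2 k" using D2 t by simp
      finally show "norm ((sqrt (p s0) - sqrt (exp (v k s0)))\<^sup>2) \<le> D1 k + t * D2 k" by simp
    qed
    moreover have "(\<lambda>k. (sqrt (p s0) - sqrt (exp (v k s0)))\<^sup>2) \<longlonglongrightarrow> (sqrt (p s0) - sqrt (q s0))\<^sup>2"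
      using v(3)[of s0] True by (intro tendsto_intros) (auto simp: U_def)
    ultimately have "(sqrt (p s0) - sqrt (q s0))\<^sup>2 = 0" using LIMSEQ_unique by blast
    then show ?thesis by simp
  qed
qed

section \<open>Surjectivity by constrained maximization\<close>

text \<open>The sublevel set is compact on \<open>Y\<close>: its elements are bounded above by
  \<open>\<beta> * F\<close>, hence below by \<open>W_abs_le\<close>. It contains 0, so a maximizing
  sequence exists and has a limit point.\<close>

lemma partition_fun_maximizer_exists:
  assumes "partition_fun \<beta> (\<lambda>_. 0) \<le> 1" and \<beta>: "\<beta> \<ge> 0"
  shows "\<exists>l\<in>W. partition_fun \<beta> l \<le> 1 \<and> (\<forall>c\<in>W. partition_fun \<beta> c \<le> 1 \<longrightarrow> (\<Sum>b\<in>B. \<xi> b * c b) \<le> (\<Sum>b\<in>B. \<xi> b * l b))"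
proof -
  define K where "K = {c \<in> W. partition_fun \<beta> c \<le> 1}"
  define J where "J c = (\<Sum>b\<in>B. \<xi> b * c b)" for c :: "'a \<Rightarrow> real"
  have "(\<lambda>_. 0) \<in> K" using assms W_zero by (simp add: K_def)
  then have ne: "J ` K \<noteq> {}" by blast
  define M where "M s = \<beta> * F s" for s
  have M: "M t \<ge> 0" if "t \<in> Y" for t using F_pos[OF that] \<beta> by (simp add: M_def less_imp_le)
  have cM: "c s \<le> M s" if "c \<in> K" "s \<in> Y" for c s
    using exponent_le_0[of \<beta> c s] that by (simp add: K_def M_def)
  have "J c \<le> (\<Sum>b\<in>B. \<bar>\<xi> b\<bar> * (M b + (\<Sum>t\<in>Y. m b t * M t)))" if "c \<in> K" for c
    unfolding J_def
  proof (rule sum_mono)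
    fix b assume b: "b \<in> B"
    have "\<bar>c b\<bar> \<le> M b + (\<Sum>t\<in>Y. m b t * M t)"
      by (rule W_abs_le) (use that M cM b B_subset in \<open>auto simp: K_def\<close>)
    then have "\<bar>\<xi> b\<bar> * \<bar>c b\<bar> \<le> \<bar>\<xi> b\<bar> * (M b + (\<Sum>t\<in>Y. m b t * M t))" by (rule mult_left_mono) simp
    then show "\<xi> b * c b \<le> \<bar>\<xi> b\<bar> * (M b + (\<Sum>t\<in>Y. m b t * M t))"
      using abs_ge_self[of "\<xi> b * c b"] by (simp add: abs_mult)
  qed
  then have bdd: "bdd_above (J ` K)" by (intro bdd_aboveI2)
  have "\<exists>c\<in>K. Sup (J ` K) - 1 / real (Suc k) < J c" for k
    using less_cSupD[OF ne, of "Sup (J ` K) - 1 / real (Suc k)"] by auto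
  then obtain c where c: "\<And>k. c k \<in> K" "\<And>k. Sup (J ` K) - 1 / real (Suc k) < J (c k)" by metis
  obtain r l where r: "strict_mono (r :: nat \<Rightarrow> nat)" and l: "l \<in> W" "\<And>s. s \<in> Y \<Longrightarrow> (\<lambda>k. c (r k) s) \<longlonglongrightarrow> l s"
    using W_bounded_subsequence[of c M] c(1) cM M by (auto simp: K_def)
  have "(\<lambda>k. partition_fun \<beta> (c (r k))) \<longlonglongrightarrow> partition_fun \<beta> l"
    unfolding partition_fun_def using l by (intro tendsto_intros) auto
  then have "partition_fun \<beta> l \<le> 1" by (rule LIMSEQ_le_const2) (use c(1) in \<open>auto simp: K_def\<close>)
  have "(\<lambda>k. J (c (r k))) \<longlonglongrightarrow> J l"
    unfolding J_def using l B_subset by (intro tendsto_intros) auto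
  moreover have "(\<lambda>k. Sup (J ` K) - 1 / real (Suc (r k))) \<longlonglongrightarrow> Sup (J ` K) - 0"
    using LIMSEQ_subseq_LIMSEQ[OF LIMSEQ_inverse_real_of_nat r]
    by (intro tendsto_intros) (simp add: o_def inverse_eq_divide)
  moreover have "Sup (J ` K) - 1 / real (Suc (r k)) \<le> J (c (r k))" for k
    using c(2) by (rule less_imp_le)
  ultimately have "Sup (J ` K) - 0 \<le> J l" by (intro LIMSEQ_le) auto
  then have "J d \<le> J l" if "d \<in> W" "partition_fun \<beta> d \<le> 1" for d
    using cSup_upper[OF _ bdd, of "J d"] that by (simp add: K_def)
  then show ?thesis using l(1) \<open>partition_fun \<beta> l \<le> 1\<close> unfolding J_def by blast
qed

text \<open>Lagrange multipliers: the gradient of the partition function at \<open>l\<close> is the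
  moment of its Gibbs weights, and at a maximizer of the functional \<open>\<xi>\<close> it must
  point along \<open>\<xi>\<close>.\<close>

lemma moment_direction_attained:
  assumes small: "partition_fun \<beta> (\<lambda>_. 0) < 1" and \<beta>: "\<beta> \<ge> 0" and \<xi>: "(\<Sum>b\<in>B. (\<xi> b)\<^sup>2) = 1"
  shows "\<exists>c\<in>W. partition_fun \<beta> c = 1 \<and> (\<exists>t>0. \<forall>b\<in>B. moment (\<lambda>s. exp (c s - \<beta> * F s)) b = t * \<xi> b)"
proof -
  obtain l where l: "l \<in> W" "partition_fun \<beta> l \<le> 1"
    and max: "\<And>c. c \<in> W \<Longrightarrow> partition_fun \<beta> c \<le> 1 \<Longrightarrow> (\<Sum>b\<in>B. \<xi> b * c b) \<le> (\<Sum>b\<in>B. \<xi> b * l b)"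
    using partition_fun_maximizer_exists[of \<beta> \<xi>] assms by (metis less_imp_le)
  define p where "p s = exp (l s - \<beta> * F s)" for s
  \<comment> \<open>If the constraint is slack, or decreases to first order along \<open>h\<close>,
    a short step stays feasible, so the objective cannot grow along \<open>h\<close>.\<close>
  have dir: "(\<Sum>b\<in>B. \<xi> b * h b) \<le> 0" if h: "h \<in> W" and desc: "partition_fun \<beta> l < 1 \<or> (\<Sum>s\<in>Y. p s * h s) < 0" for h
  proof -
    define \<phi> where "\<phi> e = partition_fun \<beta> (\<lambda>s. l s + e * h s)" for e
    have der: "DERIV \<phi> 0 :> (\<Sum>s\<in>Y. p s * h s)"
      unfolding \<phi>_def partition_fun_def p_def
      by (auto intro!: derivative_eq_intros sum.cong)
    have "\<exists>e>0. \<phi> e \<le> 1"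
    proof (cases "partition_fun \<beta> l < 1")
      case True
      have "isCont \<phi> 0" using der by (rule DERIV_isCont)
      moreover have "\<phi> 0 < 1" using True by (simp add: \<phi>_def)
      ultimately have "\<forall>\<^sub>F e in at 0. \<phi> e < 1" unfolding isCont_def by (rule order_tendstoD)
      then have "\<forall>\<^sub>F e in at_right 0. \<phi> e < 1" by (simp add: eventually_at_split)
      moreover have "\<forall>\<^sub>F e in at_right 0. (0::real) < e" by (rule eventually_at_right_less)
      ultimately have "\<forall>\<^sub>F e in at_right 0. \<phi> e < 1 \<and> 0 < e" by eventually_elim simp
      then obtain e where "\<phi> e < 1" "0 < e" using eventually_happens'[OF trivial_limit_at_right_real] by blast
      then show ?thesis by (intro exI[of _ e]) simp
    next
      case False
      then obtain d where d: "d > 0" "\<And>e. e > 0 \<Longrightarrow> e < d \<Longrightarrow> \<phi> (0 + e) < \<phi> 0"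
        using DERIV_neg_dec_right[OF der] desc by blast
      have "\<phi> 0 \<le> 1" using l by (simp add: \<phi>_def)
      then show ?thesis using d(2)[of "d / 2"] d(1) by (intro exI[of _ "d / 2"]) auto
    qed
    then obtain e where e: "e > 0" "\<phi> e \<le> 1" by blast
    have "(\<Sum>b\<in>B. \<xi> b * (l b + e * h b)) \<le> (\<Sum>b\<in>B. \<xi> b * l b)"
      by (rule max) (use e l h in \<open>auto simp: \<phi>_def intro: W_add W_scale\<close>)
    then have "e * (\<Sum>b\<in>B. \<xi> b * h b) \<le> 0"
      by (simp add: distrib_left sum.distrib sum_distrib_left mult.left_commute)
    then show ?thesis using e by (simp add: mult_le_0_iff)
  qed
  \<comment> \<open>A slack constraint would admit the direction \<open>\<xi>\<close> itself, along
    which the objective grows at rate 1. Hence the constraint is active.\<close>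
  have "(\<Sum>b\<in>B. \<xi> b * W_ext \<xi> b) = 1" using \<xi> W_ext_basis by (simp add: power2_eq_square)
  then have part_l: "partition_fun \<beta> l = 1" using dir[OF W_ext_in_W, of \<xi>] l by force
  have "\<exists>t>0. \<forall>b\<in>B. moment p b = t * \<xi> b"
  proof (rule halfspace_inclusion_imp_parallel[OF finite_B _ \<xi>])
    \<comment> \<open>The tangent-line bound for exp at \<open>l\<close>, compared with 0: as 0 is
      strictly feasible, the pairing of \<open>l\<close> with the gradient is positive, and the
      gradient cannot vanish.\<close>
    have "exp (l s - \<beta> * F s) - exp (- \<beta> * F s) \<le> p s * l s" for s
    proof -
      have "p s * (1 + - l s) \<le> p s * exp (- l s)" unfolding p_def by (intro mult_left_mono exp_ge_add_one_self) simp
      also have "\<dots> = exp (- \<beta> * F s)" by (simp add: p_def flip: exp_add)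
      finally show ?thesis by (simp add: p_def algebra_simps)
    qed
    then have "partition_fun \<beta> l - partition_fun \<beta> (\<lambda>_. 0) \<le> (\<Sum>s\<in>Y. p s * l s)"
      unfolding partition_fun_def by (simp add: sum_mono flip: sum_subtractf)
    then show "0 < (\<Sum>b\<in>B. l b * moment p b)" using W_pairing[OF l(1), of p] part_l small by simp
  next
    fix h assume "(\<Sum>b\<in>B. h b * moment p b) < 0"
    then have "(\<Sum>b\<in>B. W_ext h b * moment p b) < 0" using W_ext_basis by simp
    then have "(\<Sum>s\<in>Y. p s * W_ext h s) < 0" using W_pairing[OF W_ext_in_W] by simp
    then have "(\<Sum>b\<in>B. \<xi> b * W_ext h b) \<le> 0" using dir[OF W_ext_in_W] by blast
    then show "(\<Sum>b\<in>B. \<xi> b * h b) \<le> 0" using W_ext_basis by simp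
  qed
  then show ?thesis using l part_l unfolding p_def by blast
qed

lemma eventually_partition_fun_small: "\<forall>\<^sub>F \<beta> in at_top. partition_fun \<beta> (\<lambda>_. 0) < 1"
proof -
  have "((\<lambda>\<beta>. partition_fun \<beta> (\<lambda>_. 0)) \<longlongrightarrow> (\<Sum>s\<in>Y. 0)) at_top"
    unfolding partition_fun_def
  proof (intro tendsto_sum)
    fix s assume "s \<in> Y"
    then have "filterlim (\<lambda>\<beta>. - F s * \<beta>) at_bot at_top"
      using F_pos by (intro filterlim_tendsto_neg_mult_at_bot[OF tendsto_const] filterlim_ident) auto
    then show "((\<lambda>\<beta>. exp (0 - \<beta> * F s)) \<longlongrightarrow> 0) at_top"
      using filterlim_compose[OF exp_at_bot] by (simp add: mult.commute)
  qed
  then show ?thesis by (intro order_tendstoD) auto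
qed

text \<open>The direction \<open>\<xi>\<close> is attained for every large \<open>\<beta>\<close>,
  and a limit point of these Gibbs vectors keeps it because \<open>moment_nonzero\<close> prevents
  its moment from collapsing to 0.\<close>

lemma moment_surjective:
  assumes \<xi>: "(\<Sum>b\<in>B. (\<xi> b)\<^sup>2) = 1"
  shows "\<exists>p\<in>limit_set. \<exists>t>0. \<forall>b\<in>B. moment p b = t * \<xi> b"
proof -
  obtain \<beta>0 where \<beta>0: "\<And>\<beta>. \<beta> \<ge> \<beta>0 \<Longrightarrow> partition_fun \<beta> (\<lambda>_. 0) < 1"
    using eventually_partition_fun_small by (auto simp: eventually_at_top_linorder)
  \<comment> \<open>The maximum keeps 0 strictly feasible while \<open>\<beta>\<close> goes to
    infinity.\<close>
  define \<beta> where "\<beta> k = max \<beta>0 (real k)" for k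
  have "\<exists>c. c \<in> W \<and> partition_fun (\<beta> k) c = 1 \<and> (\<exists>t>0. \<forall>b\<in>B. moment (\<lambda>s. exp (c s - \<beta> k * F s)) b = t * \<xi> b)" for k
    using moment_direction_attained[OF \<beta>0[of "\<beta> k"] _ \<xi>] by (fastforce simp: \<beta>_def)
  then obtain c where c: "\<And>k. c k \<in> W" "\<And>k. partition_fun (\<beta> k) (c k) = 1"
    "\<And>k. \<exists>t>0. \<forall>b\<in>B. moment (\<lambda>s. exp (c k s - \<beta> k * F s)) b = t * \<xi> b" by metis
  define x where "x k s = exp (c k s - \<beta> k * F s)" for k s
  have x: "0 \<le> x k s" "s \<in> Y \<Longrightarrow> x k s \<le> 1" "sum (x k) Y = 1" for k s
    using exponent_le_0[of "\<beta> k" "c k" s] c by (auto simp: x_def partition_fun_def)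
  have "\<exists>r l. strict_mono (r :: nat \<Rightarrow> nat) \<and> (\<forall>s\<in>Y. (\<lambda>k. x (r k) s) \<longlonglongrightarrow> l s)"
    by (rule finite_coordinates_subsequence[OF finite_Y, of x "\<lambda>_. 1"]) (use x in auto)
  then obtain r l where r: "strict_mono (r :: nat \<Rightarrow> nat)" and l: "\<And>s. s \<in> Y \<Longrightarrow> (\<lambda>k. x (r k) s) \<longlonglongrightarrow> l s"
    by blast
  define p where "p = restrict l Y"
  have lp: "(\<lambda>k. x (r k) s) \<longlonglongrightarrow> p s" if "s \<in> Y" for s using l that by (simp add: p_def)
  have p01: "0 \<le> p s" "p s \<le> 1" if "s \<in> Y" for s
    using LIMSEQ_le_const[OF lp[OF that]] LIMSEQ_le_const2[OF lp[OF that]] x that by blast+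
  have "(\<lambda>k. sum (x (r k)) Y) \<longlonglongrightarrow> sum p Y" using lp by (intro tendsto_sum)
  then have "sum p Y = 1" using x(3) by (simp add: LIMSEQ_const_iff)
  then have Delta: "p \<in> Delta Y" using p01 by (auto simp: Delta_def p_def)
  have "p \<in> limit_set"
    unfolding limit_set_def
  proof (intro CollectI conjI allI Delta)
    fix k :: nat
    have "\<forall>\<^sub>F j in sequentially. \<forall>s\<in>Y. dist (x (r j) s) (p s) < 1 / (real k + 1)"
      using lp by (intro eventually_ball_finite[OF finite_Y] ballI tendstoD) auto
    moreover have "\<forall>\<^sub>F j in sequentially. j \<ge> k" by (rule eventually_ge_at_top)
    ultimately have "\<forall>\<^sub>F j in sequentially. (\<forall>s\<in>Y. dist (x (r j) s) (p s) < 1 / (real k + 1)) \<and> j \<ge> k"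
      by eventually_elim simp
    then obtain j where j: "\<forall>s\<in>Y. dist (x (r j) s) (p s) < 1 / (real k + 1)" "j \<ge> k"
      using eventually_happens' sequentially_bot by blast
    have "real k \<le> \<beta> (r j)" using j(2) seq_suble[OF r, of j] by (simp add: \<beta>_def)
    then show "\<exists>\<beta>\<ge>real k. \<exists>c\<in>W. partition_fun \<beta> c = 1 \<and>
        (\<forall>s\<in>Y. \<bar>exp (c s - \<beta> * F s) - p s\<bar> < 1 / (real k + 1))"
      using c j by (intro exI[of _ "\<beta> (r j)"] conjI bexI[of _ "c (r j)"]) (auto simp: x_def dist_real_def)
  qed
  \<comment> \<open>Since \<open>\<xi>\<close> is a unit vector, this recovers the multiplier
    \<open>t\<close> as a linear function of the weights, which passes to the limit.\<close>
  define \<tau> where "\<tau> q = (\<Sum>b\<in>B. \<xi> b * moment q b)" for q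
  have mx: "moment (x k) b = \<tau> (x k) * \<xi> b" and \<tau>x: "\<tau> (x k) > 0" if "b \<in> B" for k b
  proof -
    obtain t where t: "t > 0" "\<And>b. b \<in> B \<Longrightarrow> moment (x k) b = t * \<xi> b" using c(3) unfolding x_def by blast
    have "\<tau> (x k) = (\<Sum>b\<in>B. t * (\<xi> b)\<^sup>2)"
      unfolding \<tau>_def using t by (intro sum.cong) (auto simp: power2_eq_square)
    then have "\<tau> (x k) = t" using \<xi> by (simp flip: sum_distrib_left)
    with t that show "moment (x k) b = \<tau> (x k) * \<xi> b" "\<tau> (x k) > 0" by auto
  qed
  have lim_m: "(\<lambda>k. moment (x (r k)) b) \<longlonglongrightarrow> moment p b" for b
    unfolding moment_def using lp by (intro tendsto_intros) auto
  have lim_\<tau>: "(\<lambda>k. \<tau> (x (r k))) \<longlonglongrightarrow> \<tau> p" unfolding \<tau>_def using lim_m by (intro tendsto_intros)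
  have eq: "moment p b = \<tau> p * \<xi> b" if "b \<in> B" for b
  proof -
    have "(\<lambda>k. \<tau> (x (r k)) * \<xi> b) \<longlonglongrightarrow> \<tau> p * \<xi> b" using lim_\<tau> by (intro tendsto_intros)
    then show ?thesis using lim_m[of b] mx[OF that] LIMSEQ_unique by (simp add: LIMSEQ_unique)
  qed
  obtain b where b: "b \<in> B" "moment p b \<noteq> 0" using moment_nonzero[OF \<open>p \<in> limit_set\<close>] by blast
  have "\<tau> p \<ge> 0" using lim_\<tau> by (rule LIMSEQ_le_const) (use \<tau>x[OF b(1)] in \<open>auto intro: less_imp_le\<close>)
  moreover have "\<tau> p \<noteq> 0" using b eq by auto
  ultimately show ?thesis using eq \<open>p \<in> limit_set\<close> by (intro bexI[of _ p] exI[of _ "\<tau> p"]) auto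
qed

end

section \<open>The homeomorphism\<close>

lemma topspace_Delta_topology: "topspace (Delta_topology Y) = Delta Y"
  by (auto simp: Delta_topology_def Delta_def)

lemma compact_space_Delta_topology: "finite Y \<Longrightarrow> compact_space (Delta_topology Y)"
proof -
  assume Y: "finite Y"
  have "continuous_map (powertop_real Y) euclideanreal (\<lambda>p. \<Sum>s\<in>Y. p s)"
    by (intro continuous_map_sum Y continuous_map_product_projection)
  then have "closedin (powertop_real Y) {p \<in> topspace (powertop_real Y). (\<Sum>s\<in>Y. p s) \<in> {1}}"
    by (rule closedin_continuous_map_preimage) auto
  moreover have "compactin (powertop_real Y) (PiE Y (\<lambda>_. {0..1}))"
    by (simp add: compactin_PiE)
  ultimately have "compactin (powertop_real Y)
      ({p \<in> topspace (powertop_real Y). (\<Sum>s\<in>Y. p s) \<in> {1}} \<inter> PiE Y (\<lambda>_. {0..1}))"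
    by (rule closed_Int_compactin)
  moreover have "{p \<in> topspace (powertop_real Y). (\<Sum>s\<in>Y. p s) \<in> {1}} \<inter> PiE Y (\<lambda>_. {0..1}) = Delta Y"
    by (auto simp: Delta_def)
  ultimately show ?thesis by (simp add: Delta_topology_def compact_space_subtopology)
qed

context positively_spanning_system
begin

definition gibbs :: "real \<Rightarrow> ('a \<Rightarrow> real) set"
  where "gibbs \<beta> = (\<lambda>c. \<lambda>s\<in>Y. exp (c s - \<beta> * F s)) ` {c \<in> W. partition_fun \<beta> c = 1}"

lemma gibbs_subset_Delta: "gibbs \<beta> \<subseteq> Delta Y"
proof
  fix p assume "p \<in> gibbs \<beta>"
  then obtain c where c: "partition_fun \<beta> c = 1" "p = (\<lambda>s\<in>Y. exp (c s - \<beta> * F s))" by (auto simp: gibbs_def)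
  have "exp (c s - \<beta> * F s) \<le> 1" if "s \<in> Y" for s using exponent_le_0[of \<beta> c s] c that by simp
  then show "p \<in> Delta Y" using c by (auto simp: Delta_def partition_fun_def)
qed

text \<open>The unions decrease as \<open>r\<close> grows, so the intersection is governed by
  arbitrarily large \<open>r\<close>. Since \<open>Y\<close> is finite, boxes with all sides small
  are neighbourhoods in the product topology.\<close>

lemma gibbs_limit_eq_limit_set:
  "(\<Inter>r\<in>{b0<..}. Delta_topology Y closure_of (\<Union>\<beta>\<in>{r..}. gibbs \<beta>)) = limit_set"
proof (intro equalityI subsetI)
  fix p assume p: "p \<in> (\<Inter>r\<in>{b0<..}. Delta_topology Y closure_of (\<Union>\<beta>\<in>{r..}. gibbs \<beta>))"
  then have "p \<in> Delta_topology Y closure_of (\<Union>\<beta>\<in>{b0 + 1..}. gibbs \<beta>)" by auto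
  then have pD: "p \<in> Delta Y" by (simp add: in_closure_of topspace_Delta_topology)
  show "p \<in> limit_set"
    unfolding limit_set_def
  proof (intro CollectI conjI allI pD)
    fix k :: nat
    define V where "V = PiE Y (\<lambda>s. ball (p s) (1 / (real k + 1)))"
    have "openin (powertop_real Y) V" unfolding V_def using finite_Y by (simp add: openin_PiE)
    then have V: "openin (Delta_topology Y) (V \<inter> Delta Y)"
      unfolding Delta_topology_def openin_subtopology by blast
    have "p \<in> V \<inter> Delta Y" using pD by (auto simp: V_def Delta_def PiE_iff)
    \<comment> \<open>The maximum exceeds \<open>b0\<close>, so it is an admissible
      \<open>r\<close>, and it is at least \<open>k\<close>.\<close>
    moreover have "p \<in> Delta_topology Y closure_of (\<Union>\<beta>\<in>{max (b0 + 1) (real k)..}. gibbs \<beta>)"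
      using p by auto
    ultimately obtain q where "q \<in> V" "q \<in> (\<Union>\<beta>\<in>{max (b0 + 1) (real k)..}. gibbs \<beta>)"
      using V unfolding in_closure_of by blast
    then obtain \<beta> c where "\<beta> \<ge> real k" "c \<in> W" "partition_fun \<beta> c = 1" "q = (\<lambda>s\<in>Y. exp (c s - \<beta> * F s))"
      by (auto simp: gibbs_def)
    moreover have "\<bar>exp (c s - \<beta> * F s) - p s\<bar> < 1 / (real k + 1)" if "s \<in> Y" for s
      using \<open>q \<in> V\<close> calculation that by (auto simp: V_def PiE_iff dist_real_def abs_minus_commute)
    ultimately show "\<exists>\<beta>\<ge>real k. \<exists>c\<in>W. partition_fun \<beta> c = 1 \<and>
        (\<forall>s\<in>Y. \<bar>exp (c s - \<beta> * F s) - p s\<bar> < 1 / (real k + 1))" by blast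
  qed
next
  fix p assume p: "p \<in> limit_set"
  then have pD: "p \<in> Delta Y" by (simp add: limit_set_def)
  have "\<forall>k::nat. \<exists>\<beta> c. \<beta> \<ge> real k \<and> c \<in> W \<and> partition_fun \<beta> c = 1 \<and>
    (\<forall>s\<in>Y. \<bar>exp (c s - \<beta> * F s) - p s\<bar> < 1 / (real k + 1))"
    using p unfolding limit_set_def by blast
  then obtain \<beta> c where \<beta>: "\<And>k::nat. \<beta> k \<ge> real k" and c: "\<And>k. c k \<in> W" "\<And>k. partition_fun (\<beta> k) (c k) = 1"
    and near: "\<And>k s. s \<in> Y \<Longrightarrow> \<bar>exp (c k s - \<beta> k * F s) - p s\<bar> < 1 / (real k + 1)"
    by metis
  define x where "x k = (\<lambda>s\<in>Y. exp (c k s - \<beta> k * F s))" for k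
  have xg: "x k \<in> gibbs (\<beta> k)" for k using c by (auto simp: x_def gibbs_def)
  have "(\<lambda>k. x k s) \<longlonglongrightarrow> p s" if "s \<in> Y" for s
  proof -
    have "(\<lambda>k. x k s - p s) \<longlonglongrightarrow> 0"
    proof (rule Lim_null_comparison)
      show "\<forall>\<^sub>F k in sequentially. norm (x k s - p s) \<le> inverse (real (Suc k))"
        using near[OF that] that
        by (intro always_eventually allI) (simp add: x_def inverse_eq_divide add.commute less_imp_le)
    qed (rule LIMSEQ_inverse_real_of_nat)
    then show ?thesis by (simp add: LIM_zero_iff)
  qed
  then have lim: "limitin (powertop_real Y) x p sequentially"
    using pD by (auto simp: limitin_componentwise x_def Delta_def PiE_iff)
  show "p \<in> (\<Inter>r\<in>{b0<..}. Delta_topology Y closure_of (\<Union>\<beta>\<in>{r..}. gibbs \<beta>))"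
  proof (intro INT_I, unfold in_closure_of topspace_Delta_topology, intro conjI pD allI impI)
    fix r T assume T: "p \<in> T \<and> openin (Delta_topology Y) T"
    then obtain T' where T': "openin (powertop_real Y) T'" "T = T' \<inter> Delta Y"
      unfolding Delta_topology_def openin_subtopology by blast
    have "\<forall>\<^sub>F k in sequentially. x k \<in> T'" using lim T T' by (auto simp: limitin_def)
    moreover have "\<forall>\<^sub>F k in sequentially. r \<le> real k" by real_asymp
    ultimately have "\<forall>\<^sub>F k in sequentially. x k \<in> T' \<and> r \<le> real k" by eventually_elim simp
    then obtain k where k: "x k \<in> T'" "r \<le> real k"
      using eventually_happens' sequentially_bot by blast
    have "r \<le> \<beta> k" using k \<beta>[of k] by simp
    then show "\<exists>y. y \<in> (\<Union>\<beta>\<in>{r..}. gibbs \<beta>) \<and> y \<in> T"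
      using xg[of k] gibbs_subset_Delta[of "\<beta> k"] k T' by (intro exI[of _ "x k"]) auto
  qed
qed

text \<open>The normalized moment map \<open>g\<close> is a continuous bijection from a compact
  space to a Hausdorff space. The bijection \<open>e\<close> renames \<open>B\<close> as the
  coordinates of the sphere.\<close>

lemma limit_set_homeomorphic_nsphere:
  assumes card_B: "card B = Suc d"
  shows "subtopology (Delta_topology Y) limit_set homeomorphic_space nsphere d"
proof -
  let ?X = "subtopology (Delta_topology Y) limit_set"
  have "limit_set \<subseteq> Delta Y" by (auto simp: limit_set_def)
  then have top_X: "topspace ?X = limit_set" by (auto simp: topspace_Delta_topology)
  have "closedin (Delta_topology Y) limit_set"
    unfolding gibbs_limit_eq_limit_set[of 0, symmetric] by (intro closedin_INT) auto
  then have "compactin (Delta_topology Y) limit_set"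
    using compact_space_Delta_topology[OF finite_Y] closedin_compact_space by blast
  then have compact_X: "compact_space ?X" by (rule compact_space_subtopology)
  have Hausdorff: "Hausdorff_space (nsphere d)"
    unfolding nsphere by (intro Hausdorff_space_subtopology) (simp add: Hausdorff_space_product_topology)
  obtain e where e: "bij_betw e {..<Suc d} B"
    using ex_bij_betw_nat_finite[OF finite_B] card_B by (auto simp: atLeast0LessThan)
  then have eB: "e i \<in> B" if "i < Suc d" for i using that by (auto simp: bij_betw_def)
  define nrm where "nrm p = sqrt (\<Sum>i\<le>d. (moment p (e i))\<^sup>2)" for p
  \<comment> \<open>Points of \<open>nsphere d\<close> are sequences that vanish beyond index
    \<open>d\<close>, hence the padding by 0.\<close>
  define g where "g p i = (if i < Suc d then moment p (e i) / nrm p else 0)" for p i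
  have nrm: "nrm p > 0" if p: "p \<in> limit_set" for p
  proof -
    obtain b where b: "b \<in> B" "moment p b \<noteq> 0" using moment_nonzero[OF p] by blast
    then obtain i where i: "i < Suc d" "b = e i" using e by (force simp: bij_betw_def)
    have "0 < (\<Sum>i\<le>d. (moment p (e i))\<^sup>2)"
      by (rule sum_pos2[of _ i]) (use b i in auto)
    then show ?thesis by (simp add: nrm_def)
  qed
  have cont_moment: "continuous_map ?X euclideanreal (\<lambda>p. moment p b)" for b
    unfolding moment_def Delta_topology_def subtopology_subtopology
    by (intro continuous_map_from_subtopology continuous_map_sum finite_Y continuous_map_real_mult
        continuous_map_product_projection) auto
  have cont_nrm: "continuous_map ?X euclideanreal nrm"
    unfolding nrm_def
    by (intro continuous_map_sqrt continuous_map_sum continuous_map_real_pow cont_moment) auto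
  have "continuous_map ?X (Euclidean_space (Suc d)) g"
    unfolding g_def continuous_map_componentwise_Euclidean_space
    by (intro allI impI continuous_map_real_divide cont_moment cont_nrm)
      (use nrm top_X in force)
  moreover have sphere: "(\<Sum>i\<le>d. (g p i)\<^sup>2) = 1" if "p \<in> limit_set" for p
  proof -
    have "(\<Sum>i\<le>d. (g p i)\<^sup>2) = (\<Sum>i\<le>d. (moment p (e i))\<^sup>2) / (nrm p)\<^sup>2"
      by (simp add: g_def power_divide sum_divide_distrib)
    also have "(nrm p)\<^sup>2 = (\<Sum>i\<le>d. (moment p (e i))\<^sup>2)" by (simp add: nrm_def sum_nonneg)
    finally show ?thesis using nrm[OF that] by (simp add: nrm_def)
  qed
  ultimately have cont_g: "continuous_map ?X (nsphere d) g"
    using top_X by (auto simp: nsphere_def continuous_map_in_subtopology)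
  have inj: "inj_on g limit_set"
  proof (rule inj_onI)
    fix p q assume p: "p \<in> limit_set" and q: "q \<in> limit_set" and eq: "g p = g q"
    have "moment p b = (nrm p / nrm q) * moment q b" if b: "b \<in> B" for b
    proof -
      obtain i where i: "i < Suc d" "b = e i" using e b by (force simp: bij_betw_def)
      have "moment p b / nrm p = moment q b / nrm q" using fun_cong[OF eq, of i] i by (simp add: g_def)
      then show ?thesis using nrm[OF p] nrm[OF q] by (simp add: field_simps)
    qed
    then have "p s = q s" if "s \<in> Y" for s
      using moment_ray_injective[OF p q] nrm[OF p] nrm[OF q] that by (metis divide_pos_pos)
    moreover have "p \<in> extensional Y" "q \<in> extensional Y"
      using p q \<open>limit_set \<subseteq> Delta Y\<close> by (auto simp: Delta_def PiE_def subset_iff)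
    ultimately show "p = q" by (rule extensionalityI[rotated 2])
  qed
  have surj: "g ` limit_set = topspace (nsphere d)"
  proof (intro equalityI subsetI)
    fix \<xi> assume "\<xi> \<in> g ` limit_set"
    then show "\<xi> \<in> topspace (nsphere d)"
      using continuous_map_image_subset_topspace[OF cont_g] unfolding top_X by blast
  next
    fix \<xi> assume "\<xi> \<in> topspace (nsphere d)"
    then have \<xi>: "(\<Sum>i\<le>d. (\<xi> i)\<^sup>2) = 1" "\<And>i. i > d \<Longrightarrow> \<xi> i = 0" by (auto simp: nsphere)
    define \<eta> where "\<eta> b = \<xi> (inv_into {..<Suc d} e b)" for b
    have \<eta>: "\<eta> (e i) = \<xi> i" if "i < Suc d" for i
      using e that by (simp add: \<eta>_def bij_betw_def inv_into_f_f)
    have "(\<Sum>b\<in>B. (\<eta> b)\<^sup>2) = (\<Sum>i<Suc d. (\<eta> (e i))\<^sup>2)" 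
      by (rule sum.reindex_bij_betw[OF e, symmetric])
    also have "\<dots> = (\<Sum>i<Suc d. (\<xi> i)\<^sup>2)" using \<eta> by (intro sum.cong) auto
    finally have "(\<Sum>b\<in>B. (\<eta> b)\<^sup>2) = 1" using \<xi> by (simp add: lessThan_Suc_atMost)
    from moment_surjective[OF this] obtain p t where p: "p \<in> limit_set" and t: "t > 0"
      and mp: "\<And>b. b \<in> B \<Longrightarrow> moment p b = t * \<eta> b" by blast
    have m: "moment p (e i) = t * \<xi> i" if "i < Suc d" for i using mp[OF eB[OF that]] \<eta>[OF that] by simp
    have "(\<Sum>i\<le>d. (moment p (e i))\<^sup>2) = (\<Sum>i\<le>d. t\<^sup>2 * (\<xi> i)\<^sup>2)"
      using m by (intro sum.cong) (auto simp: power_mult_distrib)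
    then have "nrm p = t" using t \<xi>(1) by (simp add: nrm_def flip: sum_distrib_left)
    then have "g p = \<xi>" using m t \<xi>(2) by (auto simp: g_def fun_eq_iff)
    then show "\<xi> \<in> g ` limit_set" using p by blast
  qed
  have "homeomorphic_map ?X (nsphere d) g"
    by (rule continuous_imp_homeomorphic_map[OF cont_g compact_X Hausdorff]) (use inj surj top_X in simp_all)
  then show ?thesis by (rule homeomorphic_map_imp_homeomorphic_space)
qed

end

section \<open>Translation from the group to the positively spanning system\<close>

theorem theorem5p3:
  fixes G :: "('a, 'b) monoid_scheme" and Y :: "'a set" and F :: "'a \<Rightarrow> real" and n :: nat
  assumes "group G"
    and "Y \<subseteq> carrier G" and "finite Y" and "card Y \<ge> 2"
    and "semigroup_generate G Y = carrier G"
    and "\<And>s. s \<in> Y \<Longrightarrow> F s > 0"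
    and "has_rank (abelianization G) n" and "n \<ge> 1"
  shows "subtopology (Delta_topology Y) (N_infinity G Y F) homeomorphic_space nsphere (n - 1)"
proof -
  interpret group G by (rule assms)
  obtain B \<phi> where B: "B \<subseteq> Y" "card B = n"
    and \<phi>: "\<And>b. b \<in> B \<Longrightarrow> \<phi> b \<in> hom G real_group"
      "\<And>b b'. b \<in> B \<Longrightarrow> b' \<in> B \<Longrightarrow> \<phi> b b' = (if b' = b then 1 else 0)"
      "\<And>c g. c \<in> hom G real_group \<Longrightarrow> g \<in> carrier G \<Longrightarrow> c g = (\<Sum>b\<in>B. c b * \<phi> b g)"
    using dual_basis_on_generators[OF assms(2,3,5,7)] by blast
  \<comment> \<open>The inverse of a generator is itself a product of generators, because
    \<open>Y\<close> generates \<open>G\<close> as a semigroup.\<close>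
  have "\<exists>m::'a \<Rightarrow> real. (\<forall>t. 0 \<le> m t) \<and> (s \<in> Y \<longrightarrow> (\<forall>c\<in>hom G real_group. - c s = (\<Sum>t\<in>Y. m t * c t)))" for s
  proof (cases "s \<in> Y")
    case True
    then have s: "s \<in> carrier G" using assms(2) by blast
    then have "inv\<^bsub>G\<^esub> s \<in> semigroup_generate G Y" using assms(5) by simp
    from semigroup_generate_real_hom[OF assms(3,2) this] show ?thesis
      using real_hom_inv s by auto
  qed (auto intro: exI[of _ "\<lambda>_. 0"])
  then obtain m :: "'a \<Rightarrow> 'a \<Rightarrow> real" where m: "\<And>s t. 0 \<le> m s t"
    "\<And>s c. s \<in> Y \<Longrightarrow> c \<in> hom G real_group \<Longrightarrow> - c s = (\<Sum>t\<in>Y. m s t * c t)" by metis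
  interpret P: positively_spanning_system Y B \<phi> m F
    by unfold_locales (use assms B \<phi> m in auto)
  have hom_W: "hom G real_group \<subseteq> P.W"
    using \<phi>(3) assms(2) by (auto simp: P.W_def)
  have "N_set G Y F \<beta> = P.gibbs \<beta>" for \<beta>
  proof (intro equalityI subsetI)
    fix p assume "p \<in> N_set G Y F \<beta>"
    then show "p \<in> P.gibbs \<beta>"
      using hom_W by (force simp: N_set_def Q_set_def P.gibbs_def P.partition_fun_def exp_diff exp_minus field_simps)
  next
    fix p assume "p \<in> P.gibbs \<beta>"
    then obtain c where c: "c \<in> P.W" "P.partition_fun \<beta> c = 1" "p = (\<lambda>s\<in>Y. exp (c s - \<beta> * F s))"
      by (auto simp: P.gibbs_def)
    \<comment> \<open>An element of \<open>P.W\<close> need not be a homomorphism away from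
      \<open>Y\<close>; its interpolant from \<open>B\<close> is one, and has the same values on
      \<open>Y\<close>.\<close>
    have ext: "P.W_ext c s = c s" if "s \<in> Y" for s using c that by (simp add: P.W_def P.W_ext_def)
    have "P.W_ext c \<in> hom G real_group"
      using \<phi>(1) by (simp add: hom_real_group_iff P.W_ext_def distrib_left sum.distrib)
    then have "P.W_ext c \<in> Q_set G Y F \<beta>" using c ext by (simp add: Q_set_def P.partition_fun_def)
    moreover have "p = (\<lambda>s\<in>Y. exp (- \<beta> * F s) * exp (P.W_ext c s))"
      using c ext by (auto simp: restrict_def fun_eq_iff simp flip: exp_add)
    ultimately show "p \<in> N_set G Y F \<beta>" unfolding N_set_def by blast
  qed
  then have "N_infinity G Y F = P.limit_set"
    unfolding N_infinity_def by (simp add: P.gibbs_limit_eq_limit_set)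
  \<comment> \<open>Here \<open>n \<ge> 1\<close> keeps the subtraction of naturals from
    truncating.\<close>
  moreover have "card B = Suc (n - 1)" using B assms(8) by simp
  ultimately show ?thesis using P.limit_set_homeomorphic_nsphere by metis
qed

end
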